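(* Let $f(x,y,\sigma y,\ldots,\sigma^n y)=0$ be an algebraic $q$-difference equation ($f$ a nonzero polynomial in $n+2$ variables with complex coefficients), and let $y=cx^r$, $c\in\mathbb{C}\setminus\{0\}$, $r\in\mathbb{R}$, be a truncated solution of it. Suppose that the substitution $y=cx^r+z$ (followed, if necessary, by division by a power of $x$) brings the equation to the form $$\tilde f(x,z):=\mathcal{L}(\sigma)z+h(x,z)=0,$$ where: (1) the point $(0,1)$ is a vertex of the Newton polygon $\Gamma(\tilde f)$; (2) in the equation $\tilde f(x,z)=0$ the vertex $(0,1)$ corresponds to the term $\mathcal{L}(\sigma)z$ and only to it (so $(0,1)\notin S(h)$), where $\mathcal{L}(\sigma)=a_m\sigma^m+\ldots+a_1\sigma+a_0$ is a (nonzero) linear $q$-difference operator with constant coefficients $a_i\in\mathbb{C}$. Suppose also that $\langle (1,r),Q'\rangle\ge 0$ for every $Q'\in S'(\tilde f)=S(\tilde f)-(0,1)$. Let $k_1,\ldots,k_s$ be the critical numbers of the truncated solution $y=cx^r$. Then the equation $\tilde f(x,z)=0$ has a formal solution of the form $$z=\sum_{k}\beta_k(\log_q x)\,x^k,\qquad k\in K(k_1,\ldots,k_s),\ k>r,$$ where the $\beta_k$ are polynomials (with complex coefficients) in the variable $\log_q x$.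
   Context: Let $q\in\mathbb{C}$, $q\neq0$, with $q^k\ne1$ for all positive integers $k$; a branch of $\log q$ is fixed, $q^k=e^{k\log q}$ and $\log_q x=\log x/\log q$. The operator $\sigma$ is $(\sigma y)(x)=y(qx)$. On formal power-logarithmic series it acts by $\sigma(x^k)=q^kx^k$, $\sigma(\log_q x)=\log_q x+1$, i.e. $\sigma(\beta(\log_qx)x^k)=q^k\beta(\log_q x+1)x^k$. A formal solution is a formal series which, substituted into the equation with these rules, makes all coefficients (polynomials in $\log_q x$) of all powers of $x$ vanish. Everything is considered for $x\to0$. A $q$-difference monomial $b(x,y)$ is a product of $c_0x^{r_1}y^{r_2}$ ($c_0$ a complex constant, $r_1,r_2\in\mathbb{R}$) and finitely many factors $\sigma^ly$, $l\in\mathbb{N}$. Its vector exponent $Q(b)\in\mathbb{R}^2$ is defined by $Q(c_0x^{r_1}y^{r_2})=(r_1,r_2)$, $Q((\sigma^ly)^m)=(0,m)$, $Q(b_1b_2)=Q(b_1)+Q(b_2)$. For a finite sum $g$ of $q$-difference monomials (like monomials collected), the support $S(g)$ is the set of vector exponents of its monomials (with nonzero coefficients), $g_Q$ is the sum of its monomials with vector exponent $Q$, and the Newton polygon $\Gamma(g)$ is the convex hull of $S(g)$. The same notions are used with $z$ in place of $y$. The boundary of $\Gamma(f)$ consists of vertices $\Gamma_j^{(0)}$ and edges $\Gamma_j^{(1)}$. Put $S_j^{(d)}=S(f)\cap\Gamma_j^{(d)}$ and $\hat f_j^{(d)}=\sum_{Q\in S_j^{(d)}}f_Q$; the truncated equation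 is $\hat f_j^{(d)}=0$. The normal cone of $\Gamma_j^{(d)}$ is the set $U_j^{(d)}$ of $P\in\mathbb{R}^2$ such that $\langle P,Q\rangle=\langle P,Q'\rangle$ for $Q,Q'\in S_j^{(d)}$ and $\langle P,Q\rangle>\langle P,Q''\rangle$ for $Q\in S_j^{(d)}$, $Q''\in S(f)\setminus S_j^{(d)}$, with $\langle\cdot,\cdot\rangle$ the standard scalar product. A truncated solution of the equation $f=0$ is $y=cx^r$, $c\ne0$, that solves a truncated equation $\hat f_j^{(d)}=0$ and has $(-1,-r)\in U_j^{(d)}$. The characteristic polynomial of $\mathcal{L}(\sigma)z$ is $\nu(k)=x^{-k}\mathcal{L}(\sigma)[x^k]=\mathcal{L}(q^k)$, a polynomial in $q^k$. The roots $k$ of $\nu$ are called the eigenvalues of the truncated solution $y=cx^r$; the real eigenvalues $k$ with $k>r$ are called its critical numbers, listed as the finite list $k_1,\ldots,k_s$ (possibly empty). $S'_+(\tilde f)$ is the set of all finite sums (repetitions allowed) of points $Q'\in S'(\tilde f)$ and vectors $(k_1,-1),\ldots,(k_s,-1)$. $K(k_1,\ldots,k_s)$ is the set of all $q_1\in\mathbb{R}$ with $(q_1,-1)\in S'_+(\tilde f)$. *)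

theory Defs
  imports "HOL-Analysis.Analysis" "HOL-Library.Poly_Mapping"
    "HOL-Computational_Algebra.Polynomial"
begin

section \<open>Formal series with real exponents\<close>

text \<open>
  Formal series \<open>\<Sum>k. a k x^k\<close> with real exponents such that only finitely many exponents lie
  below any given bound; this is what makes products of series well defined.
\<close>

typedef (overloaded) 'a gps = "{f :: real \<Rightarrow> 'a::zero. \<forall>N. finite {k. k \<le> N \<and> f k \<noteq> 0}}"
  morphisms gps_coeff Abs_gps
  by (rule exI[of _ "\<lambda>_. 0"]) simp

setup_lifting type_definition_gps

lemma gps_eqI: "(\<And>k. gps_coeff F k = gps_coeff G k) \<Longrightarrow> F = G"
  by (metis gps_coeff_inject ext)

lemma finite_gps_coeff: "finite {k. k \<le> N \<and> gps_coeff F k \<noteq> 0}"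
  using gps_coeff[of F] by blast

lemma gps_lower_bound: "\<exists>b. \<forall>k. gps_coeff F k \<noteq> 0 \<longrightarrow> b \<le> k"
proof -
  let ?S = "{k. k \<le> 0 \<and> gps_coeff F k \<noteq> 0}"
  have fin: "finite (insert 0 ?S)" using finite_gps_coeff[of 0 F] by simp
  have "Min (insert 0 ?S) \<le> k" if "gps_coeff F k \<noteq> 0" for k
  proof (cases "k \<le> 0")
    case True
    then show ?thesis using that by (intro Min_le[OF fin]) simp
  next
    case False
    then show ?thesis using Min_le[OF fin insertI1] by linarith
  qed
  then show ?thesis by blast
qed

lift_definition gps_monom :: "real \<Rightarrow> 'a \<Rightarrow> 'a::zero gps"
  is "\<lambda>r c k. if k = r then c else 0"
proof -
  fix r N :: real and c :: 'a
  show "finite {k. k \<le> N \<and> (if k = r then c else 0) \<noteq> 0}"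
    by (rule finite_subset[of _ "{r}"]) auto
qed

instantiation gps :: (comm_ring_1) comm_ring_1
begin

lift_definition zero_gps :: "'a gps" is "\<lambda>_. 0" by simp

lift_definition one_gps :: "'a gps" is "\<lambda>k. if k = 0 then 1 else 0"
  by (rule finite_subset[of _ "{0}"]) auto

lift_definition plus_gps :: "'a gps \<Rightarrow> 'a gps \<Rightarrow> 'a gps" is "\<lambda>f g k. f k + g k"
proof -
  fix f g :: "real \<Rightarrow> 'a" and N :: real
  assume *: "\<And>N. finite {k. k \<le> N \<and> f k \<noteq> 0}" "\<And>N. finite {k. k \<le> N \<and> g k \<noteq> 0}"
  show "finite {k. k \<le> N \<and> f k + g k \<noteq> 0}"
    by (rule finite_subset[OF _ finite_UnI[OF *(1)[of N] *(2)[of N]]]) auto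
qed

lift_definition uminus_gps :: "'a gps \<Rightarrow> 'a gps" is "\<lambda>f k. - f k" by simp

lift_definition minus_gps :: "'a gps \<Rightarrow> 'a gps \<Rightarrow> 'a gps" is "\<lambda>f g k. f k - g k"
proof -
  fix f g :: "real \<Rightarrow> 'a" and N :: real
  assume *: "\<And>N. finite {k. k \<le> N \<and> f k \<noteq> 0}" "\<And>N. finite {k. k \<le> N \<and> g k \<noteq> 0}"
  show "finite {k. k \<le> N \<and> f k - g k \<noteq> 0}"
    by (rule finite_subset[OF _ finite_UnI[OF *(1)[of N] *(2)[of N]]]) auto
qed

text \<open>The Cauchy product; the index set of the sum is always finite.\<close>

definition times_gps :: "'a gps \<Rightarrow> 'a gps \<Rightarrow> 'a gps" where
  "F * G = Abs_gps (\<lambda>k. \<Sum>i | gps_coeff F i \<noteq> 0 \<and> gps_coeff G (k - i) \<noteq> 0.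
                          gps_coeff F i * gps_coeff G (k - i))"

lemma finite_gps_times_index:
  fixes F G :: "'a gps"
  shows "finite {i. gps_coeff F i \<noteq> 0 \<and> gps_coeff G (k - i) \<noteq> 0}"
proof -
  obtain b where "\<forall>k. gps_coeff G k \<noteq> 0 \<longrightarrow> b \<le> k" using gps_lower_bound by blast
  then have "b \<le> k - i" if "gps_coeff G (k - i) \<noteq> 0" for i
    using that by blast
  then have "i \<le> k - b" if "gps_coeff G (k - i) \<noteq> 0" for i
    using that by fastforce
  then have "{i. gps_coeff F i \<noteq> 0 \<and> gps_coeff G (k - i) \<noteq> 0}
      \<subseteq> {i. i \<le> k - b \<and> gps_coeff F i \<noteq> 0}"
    by blast
  then show ?thesis by (rule finite_subset) (rule finite_gps_coeff)
qed

lemma gps_coeff_times_raw: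
  fixes F G :: "'a gps"
  shows "gps_coeff (F * G) k = (\<Sum>i | gps_coeff F i \<noteq> 0 \<and> gps_coeff G (k - i) \<noteq> 0.
                          gps_coeff F i * gps_coeff G (k - i))"
proof -
  define p where "p = (\<lambda>k. \<Sum>i | gps_coeff F i \<noteq> 0 \<and> gps_coeff G (k - i) \<noteq> 0.
                          gps_coeff F i * gps_coeff G (k - i))"
  obtain b where b: "\<forall>k. gps_coeff F k \<noteq> 0 \<longrightarrow> b \<le> k" using gps_lower_bound by blast
  obtain c where c: "\<forall>k. gps_coeff G k \<noteq> 0 \<longrightarrow> c \<le> k" using gps_lower_bound by blast
  have "finite {k. k \<le> N \<and> p k \<noteq> 0}" for N
  proof (rule finite_subset)
    let ?A = "{i. i \<le> N - c \<and> gps_coeff F i \<noteq> 0}" and ?B = "{j. j \<le> N - b \<and> gps_coeff G j \<noteq> 0}"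
    show "finite ((\<lambda>(i, j). i + j) ` (?A \<times> ?B))"
      by (intro finite_imageI finite_cartesian_product finite_gps_coeff)
    show "{k. k \<le> N \<and> p k \<noteq> 0} \<subseteq> (\<lambda>(i, j). i + j) ` (?A \<times> ?B)"
    proof
      fix k assume k: "k \<in> {k. k \<le> N \<and> p k \<noteq> 0}"
      have "{i. gps_coeff F i \<noteq> 0 \<and> gps_coeff G (k - i) \<noteq> 0} \<noteq> {}"
      proof
        assume "{i. gps_coeff F i \<noteq> 0 \<and> gps_coeff G (k - i) \<noteq> 0} = {}"
        then have "p k = 0" by (simp only: p_def sum.empty)
        with k show False by simp
      qed
      then obtain i where i: "gps_coeff F i \<noteq> 0" "gps_coeff G (k - i) \<noteq> 0" by blast
      have "b \<le> i" "c \<le> k - i" "k \<le> N" using b c k i by auto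
      then have "(i, k - i) \<in> ?A \<times> ?B" using i by simp
      moreover have "k = (\<lambda>(i, j). i + j) (i, k - i)" by simp
      ultimately show "k \<in> (\<lambda>(i, j). i + j) ` (?A \<times> ?B)" by (rule image_eqI[rotated])
    qed
  qed
  then show ?thesis
    unfolding times_gps_def p_def[symmetric] by (subst Abs_gps_inverse) (simp_all add: p_def)
qed

lemma gps_times_nonzeroE:
  fixes F G :: "'a gps"
  assumes "gps_coeff (F * G) k \<noteq> 0"
  obtains i where "gps_coeff F i \<noteq> 0" "gps_coeff G (k - i) \<noteq> 0"
proof -
  have "{i. gps_coeff F i \<noteq> 0 \<and> gps_coeff G (k - i) \<noteq> 0} \<noteq> {}"
  proof
    assume "{i. gps_coeff F i \<noteq> 0 \<and> gps_coeff G (k - i) \<noteq> 0} = {}"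
    then have "gps_coeff (F * G) k = 0" by (simp only: gps_coeff_times_raw sum.empty)
    with assms show False by contradiction
  qed
  then show ?thesis using that by blast
qed

lemma gps_coeff_times:
  fixes F G :: "'a gps"
  assumes "finite A" "{i. gps_coeff F i \<noteq> 0 \<and> gps_coeff G (k - i) \<noteq> 0} \<subseteq> A"
  shows "gps_coeff (F * G) k = (\<Sum>i\<in>A. gps_coeff F i * gps_coeff G (k - i))"
  unfolding gps_coeff_times_raw
  by (rule sum.mono_neutral_left) (use assms in auto)

instance
proof
  fix F G H :: "'a gps"
  have comm: "F * G = G * F" for F G :: "'a gps"
  proof (rule gps_eqI)
    fix k
    show "gps_coeff (F * G) k = gps_coeff (G * F) k"
      unfolding gps_coeff_times_raw
      by (rule sum.reindex_bij_witness[of _ "\<lambda>i. k - i" "\<lambda>i. k - i"]) (auto simp: mult.commute)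
  qed
  show "F * G = G * F" by (rule comm)
  show "F * G * H = F * (G * H)"
  proof (rule gps_eqI)
    fix k
    obtain a where a: "\<forall>k. gps_coeff F k \<noteq> 0 \<longrightarrow> a \<le> k" using gps_lower_bound by blast
    obtain b where b: "\<forall>k. gps_coeff G k \<noteq> 0 \<longrightarrow> b \<le> k" using gps_lower_bound by blast
    obtain c where c: "\<forall>k. gps_coeff H k \<noteq> 0 \<longrightarrow> c \<le> k" using gps_lower_bound by blast
    define A where "A = {i. i \<le> k - b - c \<and> gps_coeff F i \<noteq> 0}"
    define C where "C = {l. l \<le> k - a - b \<and> gps_coeff H l \<noteq> 0}"
    have fin: "finite A" "finite C" unfolding A_def C_def by (rule finite_gps_coeff)+
    have ab: "a + b \<le> j" if nz: "gps_coeff (F * G) j \<noteq> 0" for j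
    proof -
      obtain i where i: "gps_coeff F i \<noteq> 0" "gps_coeff G (j - i) \<noteq> 0"
        using gps_times_nonzeroE[OF nz] by blast
      then have "a \<le> i" "b \<le> j - i" using a b by auto
      then show ?thesis by linarith
    qed
    have bc: "b + c \<le> j" if nz: "gps_coeff (G * H) j \<noteq> 0" for j
    proof -
      obtain i where i: "gps_coeff G i \<noteq> 0" "gps_coeff H (j - i) \<noteq> 0"
        using gps_times_nonzeroE[OF nz] by blast
      then have "b \<le> i" "c \<le> j - i" using b c by auto
      then show ?thesis by linarith
    qed
    have "gps_coeff (F * G * H) k = gps_coeff (H * (F * G)) k" by (simp only: comm[of H])
    also have "\<dots> = (\<Sum>l\<in>C. gps_coeff H l * gps_coeff (F * G) (k - l))"
    proof (rule gps_coeff_times[OF fin(2)], safe)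
      fix l assume "gps_coeff H l \<noteq> 0" "gps_coeff (F * G) (k - l) \<noteq> 0"
      then show "l \<in> C" using ab[of "k - l"] by (simp add: C_def)
    qed
    also have "\<dots> = (\<Sum>l\<in>C. gps_coeff H l * (\<Sum>i\<in>A. gps_coeff F i * gps_coeff G (k - l - i)))"
    proof (rule sum.cong[OF refl])
      fix l assume "l \<in> C"
      then have "c \<le> l" using c by (auto simp: C_def)
      have "gps_coeff (F * G) (k - l) = (\<Sum>i\<in>A. gps_coeff F i * gps_coeff G (k - l - i))"
      proof (rule gps_coeff_times[OF fin(1)], safe)
        fix i assume i: "gps_coeff F i \<noteq> 0" "gps_coeff G (k - l - i) \<noteq> 0"
        then have "b \<le> k - l - i" using b by blast
        then show "i \<in> A" using i \<open>c \<le> l\<close> by (simp add: A_def)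
      qed
      then show "gps_coeff H l * gps_coeff (F * G) (k - l) =
          gps_coeff H l * (\<Sum>i\<in>A. gps_coeff F i * gps_coeff G (k - l - i))" by simp
    qed
    also have "\<dots> = (\<Sum>i\<in>A. gps_coeff F i * (\<Sum>l\<in>C. gps_coeff H l * gps_coeff G (k - i - l)))"
      unfolding sum_distrib_left
      by (subst sum.swap, intro sum.cong refl)
        (simp only: mult.left_commute diff_diff_eq add.commute)
    also have "\<dots> = (\<Sum>i\<in>A. gps_coeff F i * gps_coeff (G * H) (k - i))"
    proof (rule sum.cong[OF refl])
      fix i assume "i \<in> A"
      then have "a \<le> i" using a by (auto simp: A_def)
      have "gps_coeff (H * G) (k - i) = (\<Sum>l\<in>C. gps_coeff H l * gps_coeff G (k - i - l))"
      proof (rule gps_coeff_times[OF fin(2)], safe)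
        fix l assume l: "gps_coeff H l \<noteq> 0" "gps_coeff G (k - i - l) \<noteq> 0"
        then have "b \<le> k - i - l" using b by blast
        then show "l \<in> C" using l \<open>a \<le> i\<close> by (simp add: C_def)
      qed
      then show "gps_coeff F i * (\<Sum>l\<in>C. gps_coeff H l * gps_coeff G (k - i - l)) =
          gps_coeff F i * gps_coeff (G * H) (k - i)" by (simp only: comm[of G])
    qed
    also have "\<dots> = gps_coeff (F * (G * H)) k"
    proof (rule gps_coeff_times[OF fin(1), symmetric], safe)
      fix i assume "gps_coeff F i \<noteq> 0" "gps_coeff (G * H) (k - i) \<noteq> 0"
      then show "i \<in> A" using bc[of "k - i"] by (simp add: A_def)
    qed
    finally show "gps_coeff (F * G * H) k = gps_coeff (F * (G * H)) k" .
  qed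
  show "1 * F = F"
  proof (rule gps_eqI)
    fix k
    have "gps_coeff (1 * F) k = (\<Sum>i\<in>{0}. gps_coeff 1 i * gps_coeff F (k - i))"
      by (rule gps_coeff_times) (auto simp: one_gps.rep_eq split: if_splits)
    then show "gps_coeff (1 * F) k = gps_coeff F k" by (simp add: one_gps.rep_eq)
  qed
  show "(F + G) * H = F * H + G * H"
  proof (rule gps_eqI)
    fix k
    define A where "A = {i. gps_coeff F i \<noteq> 0 \<and> gps_coeff H (k - i) \<noteq> 0}
      \<union> {i. gps_coeff G i \<noteq> 0 \<and> gps_coeff H (k - i) \<noteq> 0}"
    have fin: "finite A" unfolding A_def by (intro finite_UnI finite_gps_times_index)
    have "gps_coeff ((F + G) * H) k = (\<Sum>i\<in>A. gps_coeff (F + G) i * gps_coeff H (k - i))"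
      by (rule gps_coeff_times[OF fin]) (auto simp: A_def plus_gps.rep_eq)
    moreover have "gps_coeff (F * H) k = (\<Sum>i\<in>A. gps_coeff F i * gps_coeff H (k - i))"
      by (rule gps_coeff_times[OF fin]) (auto simp: A_def)
    moreover have "gps_coeff (G * H) k = (\<Sum>i\<in>A. gps_coeff G i * gps_coeff H (k - i))"
      by (rule gps_coeff_times[OF fin]) (auto simp: A_def)
    ultimately show "gps_coeff ((F + G) * H) k = gps_coeff (F * H + G * H) k"
      by (simp add: plus_gps.rep_eq sum.distrib distrib_right)
  qed
  show "(0 :: 'a gps) \<noteq> 1"
  proof
    assume "(0 :: 'a gps) = 1"
    then have "gps_coeff (0 :: 'a gps) 0 = gps_coeff 1 0" by simp
    then show False by (simp add: zero_gps.rep_eq one_gps.rep_eq)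
  qed
  show "F + G + H = F + (G + H)" "F + G = G + F" "0 + F = F" "- F + F = 0" "F - G = F + - G"
    by (rule gps_eqI; simp add: plus_gps.rep_eq zero_gps.rep_eq uminus_gps.rep_eq
        minus_gps.rep_eq add.assoc add.commute)+
qed

end

section \<open>Power-logarithmic series and the operator \<open>\<sigma>\<close>\<close>

text \<open>
  The coefficients are polynomials in the variable \<open>log_q x\<close>.  Throughout, \<open>lq\<close> is the chosen
  value of \<open>log q\<close>, i.e. \<open>exp lq = q\<close>.
\<close>

type_synonym powlog = "complex poly gps"

definition qpow :: "complex \<Rightarrow> complex \<Rightarrow> complex" where
  "qpow lq k = exp (k * lq)"

lift_definition sigma :: "complex \<Rightarrow> powlog \<Rightarrow> powlog"
  is "\<lambda>lq \<beta> k. smult (qpow lq (of_real k)) (pcompose (\<beta> k) [:1, 1:])"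
proof -
  fix lq :: complex and \<beta> :: "real \<Rightarrow> complex poly" and N :: real
  assume *: "\<And>N. finite {k. k \<le> N \<and> \<beta> k \<noteq> 0}"
  show "finite {k. k \<le> N \<and> smult (qpow lq (of_real k)) (pcompose (\<beta> k) [:1, 1:]) \<noteq> 0}"
    by (rule finite_subset[OF _ *[of N]]) auto
qed

section \<open>Finite sums of \<open>q\<close>-difference monomials\<close>

text \<open>
  The key \<open>(a, m)\<close> stands for the monomial \<open>x^a * (\<Prod>l. (\<sigma>^l y)^(m l))\<close>, and the ring structure
  is that of the monoid algebra.  A factor \<open>y^r2\<close> with natural \<open>r2\<close>, the only case arising from a
  polynomial equation, is absorbed into the exponent of \<open>\<sigma>^0 y\<close>.
\<close>

type_synonym qdiff_key = "real \<times> (nat \<Rightarrow>\<^sub>0 nat)"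
type_synonym qdiff_sum = "qdiff_key \<Rightarrow>\<^sub>0 complex"

definition qdiff_polynomial :: "nat \<Rightarrow> qdiff_sum \<Rightarrow> bool" where
  "qdiff_polynomial n f \<longleftrightarrow>
     (\<forall>(a, m) \<in> Poly_Mapping.keys f. a \<in> \<nat> \<and> Poly_Mapping.keys m \<subseteq> {..n})"

definition x_monom :: "real \<Rightarrow> complex \<Rightarrow> qdiff_sum" where
  "x_monom a c = Poly_Mapping.single (a, 0) c"

definition sigma_var :: "nat \<Rightarrow> qdiff_sum" where
  "sigma_var l = Poly_Mapping.single (0, Poly_Mapping.single l 1) 1"

definition eval_series :: "complex \<Rightarrow> qdiff_sum \<Rightarrow> powlog \<Rightarrow> powlog" where
  "eval_series lq g z = (\<Sum>(a, m) \<in> Poly_Mapping.keys g.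
     gps_monom a [:Poly_Mapping.lookup g (a, m):] *
     (\<Prod>l\<in>Poly_Mapping.keys m. ((sigma lq ^^ l) z) ^ Poly_Mapping.lookup m l))"

definition formal_solution :: "complex \<Rightarrow> qdiff_sum \<Rightarrow> powlog \<Rightarrow> bool" where
  "formal_solution lq g z \<longleftrightarrow> (\<forall>k. gps_coeff (eval_series lq g z) k = 0)"

text \<open>
  The substitution \<open>y = c x^r + z\<close>, under which \<open>\<sigma>^l y\<close> becomes \<open>q^(l r) c x^r + \<sigma>^l z\<close>.
\<close>

definition subst_shift :: "complex \<Rightarrow> complex \<Rightarrow> real \<Rightarrow> qdiff_sum \<Rightarrow> qdiff_sum" where
  "subst_shift lq c r f = (\<Sum>(a, m) \<in> Poly_Mapping.keys f.
     x_monom a (Poly_Mapping.lookup f (a, m)) *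
     (\<Prod>l\<in>Poly_Mapping.keys m. (x_monom r (qpow lq (of_nat l * of_real r) * c) + sigma_var l)
        ^ Poly_Mapping.lookup m l))"

section \<open>Supports, Newton polygons, truncated solutions\<close>

definition vexp :: "qdiff_key \<Rightarrow> real \<times> real" where
  "vexp p = (fst p, real (\<Sum>l\<in>Poly_Mapping.keys (snd p). Poly_Mapping.lookup (snd p) l))"

definition supp :: "qdiff_sum \<Rightarrow> (real \<times> real) set" where
  "supp g = vexp ` Poly_Mapping.keys g"

definition part :: "qdiff_sum \<Rightarrow> real \<times> real \<Rightarrow> qdiff_sum" where
  "part g Q = (\<Sum>p | p \<in> Poly_Mapping.keys g \<and> vexp p = Q.
     Poly_Mapping.single p (Poly_Mapping.lookup g p))"

definition newton_polygon :: "qdiff_sum \<Rightarrow> (real \<times> real) set" where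
  "newton_polygon g = convex hull (supp g)"

definition boundary_face :: "qdiff_sum \<Rightarrow> (real \<times> real) set \<Rightarrow> bool" where
  "boundary_face f \<Gamma> \<longleftrightarrow>
     (\<exists>v. v extreme_point_of newton_polygon f \<and> \<Gamma> = {v}) \<or> \<Gamma> edge_of newton_polygon f"

definition truncation :: "qdiff_sum \<Rightarrow> (real \<times> real) set \<Rightarrow> qdiff_sum" where
  "truncation f \<Gamma> = (\<Sum>Q \<in> supp f \<inter> \<Gamma>. part f Q)"

definition normal_cone :: "qdiff_sum \<Rightarrow> (real \<times> real) set \<Rightarrow> (real \<times> real) set" where
  "normal_cone f \<Gamma> = {P.
     (\<forall>Q \<in> supp f \<inter> \<Gamma>. \<forall>Q' \<in> supp f \<inter> \<Gamma>. P \<bullet> Q = P \<bullet> Q') \<and>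
     (\<forall>Q \<in> supp f \<inter> \<Gamma>. \<forall>Q'' \<in> supp f - (supp f \<inter> \<Gamma>). P \<bullet> Q > P \<bullet> Q'')}"

definition truncated_solution :: "complex \<Rightarrow> qdiff_sum \<Rightarrow> complex \<Rightarrow> real \<Rightarrow> bool" where
  "truncated_solution lq f c r \<longleftrightarrow> c \<noteq> 0 \<and>
     (\<exists>\<Gamma>. boundary_face f \<Gamma> \<and> formal_solution lq (truncation f \<Gamma>) (gps_monom r [:c:]) \<and>
          (- 1, - r) \<in> normal_cone f \<Gamma>)"

section \<open>The linear part, critical numbers and the set \<open>K\<close>\<close>

text \<open>The operator \<open>a\<^sub>m \<sigma>^m + \<dots> + a\<^sub>0\<close> is given by the polynomial with coefficients \<open>a\<^sub>i\<close>.\<close>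

definition linear_qdiff :: "complex poly \<Rightarrow> qdiff_sum" where
  "linear_qdiff L = (\<Sum>i\<le>degree L. x_monom 0 (coeff L i) * sigma_var i)"

definition char_poly_value :: "complex \<Rightarrow> complex poly \<Rightarrow> complex \<Rightarrow> complex" where
  "char_poly_value lq L k = poly L (qpow lq k)"

definition eigenvalues :: "complex \<Rightarrow> complex poly \<Rightarrow> complex set" where
  "eigenvalues lq L = {k. char_poly_value lq L k = 0}"

definition critical_numbers :: "complex \<Rightarrow> complex poly \<Rightarrow> real \<Rightarrow> real set" where
  "critical_numbers lq L r = {k. of_real k \<in> eigenvalues lq L \<and> k > r}"

definition supp' :: "qdiff_sum \<Rightarrow> (real \<times> real) set" where
  "supp' g = (\<lambda>Q. Q - (0, 1)) ` supp g"

definition supp'_plus :: "qdiff_sum \<Rightarrow> real set \<Rightarrow> (real \<times> real) set" where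
  "supp'_plus g C = {\<Sum>\<^sub># M | M. set_mset M \<subseteq> supp' g \<union> (\<lambda>k. (k, - 1)) ` C}"

definition K_set :: "qdiff_sum \<Rightarrow> real set \<Rightarrow> real set" where
  "K_set g C = {q1. (q1, - 1) \<in> supp'_plus g C}"

end

(*
  At the exponent k the equation L(sigma) z = - h(x, z) reads L(q^k T) b_k = - (coefficient of h),
  where T is the shift by 1 on polynomials in log_q x.  A nonzero polynomial in T is surjective on
  polynomials, even at an eigenvalue, where it only fails to be injective.  Choosing the preimage 0
  of 0 keeps the exponents inside the semigroup generated by S'(ft) alone, so the critical numbers
  are not even needed to describe them.

  Give x^a y^j the weight a + r j, and let all exponents of z exceed r.  By the slope hypothesis
  every monomial of h then contributes to the coefficient at k only through coefficients of z at
  exponents below k, so z is the fixed point of a causal map.  The exponents stay above r because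
  ft has no term c' x^r: the substitution y = c x^r + z preserves weights and the coefficients of
  highest degree in each weight, so the least weight of f is d + r, and the coefficient of x^r in ft
  is the value of the truncated equation at y = c x^r, which is 0.
*)
theory Submission
  imports Defs "HOL-Computational_Algebra.Fundamental_Theorem_Algebra"
begin

section \<open>Polynomials in the shift operator\<close>

text \<open>This is \<open>M(T) u\<close>, where \<open>T\<close> is the shift from
  \<open>u(t)\<close> to \<open>u(t + 1)\<close> and \<open>t\<close> stands for
  \<open>log_q x\<close>.\<close>

definition shift_op :: "complex poly \<Rightarrow> complex poly \<Rightarrow> complex poly" where
  "shift_op M u = (\<Sum>i\<le>degree M. smult (coeff M i) (pcompose u [:of_nat i, 1:]))"

text \<open>A common bound for the summation lets operators of different degrees be combined
  termwise.\<close>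

lemma shift_op_superset:
  assumes "degree M \<le> N"
  shows "shift_op M u = (\<Sum>i\<le>N. smult (coeff M i) (pcompose u [:of_nat i, 1:]))"
  unfolding shift_op_def
  by (rule sum.mono_neutral_left) (use assms in \<open>auto simp: coeff_eq_0\<close>)

lemma shift_op_diff: "shift_op (M - N) u = shift_op M u - shift_op N u"
proof -
  define d where "d = max (degree M) (degree N)"
  have "degree M \<le> d" "degree N \<le> d" "degree (M - N) \<le> d"
    by (simp_all add: d_def degree_diff_le_max)
  then show ?thesis
    by (simp add: shift_op_superset[of _ d] smult_diff_left sum_subtractf)
qed

lemma shift_op_smult: "shift_op (smult a M) u = smult a (shift_op M u)"
  by (simp add: shift_op_superset[of "smult a M" "degree M"] shift_op_def poly_eq_iff
      coeff_sum sum_distrib_left mult.assoc)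

lemma shift_op_pCons_0: "shift_op (pCons 0 M) u = pcompose (shift_op M u) [:1, 1:]"
proof -
  have "shift_op (pCons 0 M) u = (\<Sum>i\<le>Suc (degree M). smult (coeff (pCons 0 M) i) (pcompose u [:of_nat i, 1:]))"
    by (rule shift_op_superset) (simp add: degree_pCons_le)
  also have "\<dots> = (\<Sum>i\<le>degree M. smult (coeff M i) (pcompose u [:of_nat (Suc i), 1:]))"
    by (subst sum.atMost_Suc_shift) simp
  also have "\<dots> = pcompose (shift_op M u) [:1, 1:]"
    unfolding shift_op_def pcompose_sum pcompose_smult
    by (rule sum.cong[OF refl]) (simp add: pcompose_assoc[symmetric] pcompose_pCons add.commute)
  finally show ?thesis .
qed

text \<open>Splitting off a linear factor of the polynomial means applying \<open>T - l\<close>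
  last.\<close>

lemma shift_op_linear_times:
  "shift_op ([:- l, 1:] * M) u = pcompose (shift_op M u) [:1, 1:] - smult l (shift_op M u)"
proof -
  have "[:- l, 1:] * M = pCons 0 M - smult l M" by simp
  then show ?thesis by (simp only: shift_op_diff shift_op_smult shift_op_pCons_0)
qed

section \<open>Surjectivity of polynomials in the shift\<close>

text \<open>Induction on the degree of the target: subtracting a multiple of an image of the same
  degree removes the leading term.\<close>

lemma surj_if_hits_every_degree:
  fixes A :: "'a::field poly \<Rightarrow> 'a poly"
  assumes add: "\<And>u v. A (u + v) = A u + A v"
    and smult: "\<And>a u. A (smult a u) = smult a (A u)"
    and hits: "\<And>n. \<exists>u. A u \<noteq> 0 \<and> degree (A u) = n"
  shows "\<exists>u. A u = p"
proof (induction "degree p" arbitrary: p rule: less_induct)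
  case less
  obtain v where v: "A v \<noteq> 0" "degree (A v) = degree p" using hits by blast
  define a where "a = lead_coeff p / lead_coeff (A v)"
  define p' where "p' = p - A (smult a v)"
  have coeff: "coeff p' (degree p) = 0"
    using v by (simp add: p'_def smult a_def flip: v(2))
  have le: "degree p' \<le> degree p"
    unfolding p'_def smult by (rule degree_diff_le) (use v in \<open>auto intro: order.trans[OF degree_smult_le]\<close>)
  show ?case
  proof (cases "degree p' < degree p")
    case True
    from less[OF this] obtain u where "A u = p'" by blast
    then have "A (u + smult a v) = p" by (simp add: add p'_def)
    then show ?thesis by blast
  next
    \<comment> \<open>The top coefficient is gone without a drop in degree; only
      \<open>p' = 0\<close>, hence \<open>degree p = 0\<close>, allows this.\<close>
    case False
    with le coeff have "p' = 0" by (metis le_neq_implies_less leading_coeff_0_iff)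
    then have "A (smult a v) = p" by (simp add: p'_def)
    then show ?thesis by blast
  qed
qed

text \<open>For \<open>l \<noteq> 1\<close> the operator \<open>T - l\<close> preserves degrees. For
  \<open>l = 1\<close> the leading terms cancel and \<open>t^(n+1)\<close> goes to degree
  \<open>n\<close>, with leading coefficient \<open>n + 1\<close>.\<close>

lemma shift_minus_scalar_surj:
  fixes p :: "complex poly"
  shows "\<exists>u. pcompose u [:1, 1:] - smult l u = p"
proof (rule surj_if_hits_every_degree)
  fix n :: nat
  have cp: "pcompose (monom 1 k) [:1, 1:] = ([:1, 1:] :: complex poly) ^ k" for k
    by (induction k) (simp_all add: monom_altdef pcompose_1 pcompose_mult pcompose_pCons)
  show "\<exists>u. pcompose u [:1, 1:] - smult l u \<noteq> 0 \<and> degree (pcompose u [:1, 1:] - smult l u) = n"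
  proof (cases "l = 1")
    case True
    define v where "v = pcompose (monom 1 (Suc n)) [:1, 1:] - smult l (monom 1 (Suc n))"
    have c: "coeff v i = of_nat (Suc n choose i) - (if i = Suc n then 1 else 0)" if "i \<le> Suc n" for i
      using that by (simp add: v_def cp coeff_linear_poly_power True del: power_Suc binomial_Suc_Suc)
    have "degree v \<le> Suc n"
      unfolding v_def cp by (rule degree_diff_le) (auto simp: degree_linear_power degree_monom_eq True simp del: power_Suc)
    moreover have "coeff v (Suc n) = 0" "coeff v n \<noteq> 0"
      using c[of n] of_nat_neq_0[of n, where 'a = complex] by (simp_all add: c)
    moreover from this have "v \<noteq> 0" by auto
    ultimately have "degree v \<noteq> Suc n" "degree v \<le> Suc n" "n \<le> degree v"
      by (metis leading_coeff_0_iff, simp, simp add: le_degree)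
    then have "degree v = n" by linarith
    with \<open>v \<noteq> 0\<close>
    show ?thesis unfolding v_def by blast
  next
    case False
    define v where "v = pcompose (monom 1 n) [:1, 1:] - smult l (monom 1 n)"
    have "degree v \<le> n"
      unfolding v_def cp
      by (rule degree_diff_le) (auto simp: degree_linear_power degree_monom_eq intro: order.trans[OF degree_smult_le])
    moreover have "coeff v n \<noteq> 0" using False by (simp add: v_def cp coeff_linear_poly_power)
    ultimately have "degree v = n" "v \<noteq> 0" by (auto intro!: antisym le_degree)
    then show ?thesis unfolding v_def by blast
  qed
qed (simp_all add: pcompose_add pcompose_smult smult_add_right smult_diff_right mult.commute)

text \<open>A root \<open>l\<close> of a nonconstant \<open>M\<close> gives
  \<open>M(T) = (T - l) M'(T)\<close>: a preimage under \<open>T - l\<close> is found first, then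
  one under \<open>M'(T)\<close> by induction on the degree.\<close>

lemma shift_op_surj:
  assumes "M \<noteq> 0"
  shows "\<exists>u. shift_op M u = p"
  using assms
proof (induction "degree M" arbitrary: M p rule: less_induct)
  case less
  show ?case
  proof (cases "degree M = 0")
    case True
    then obtain a where "M = [:a:]" by (rule degree_eq_zeroE)
    with less.prems have "shift_op M (smult (1 / a) p) = p" by (simp add: shift_op_def)
    then show ?thesis by blast
  next
    case False
    then have "\<not> constant (poly M)" by (simp add: constant_degree)
    then obtain l where "poly M l = 0" using fundamental_theorem_of_algebra by blast
    then obtain M' where M: "M = [:- l, 1:] * M'" by (auto simp: poly_eq_0_iff_dvd dvd_def)
    with less.prems have "M' \<noteq> 0" by auto
    then have "degree M' < degree M" unfolding M by (subst degree_mult_eq) auto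
    moreover obtain v where "pcompose v [:1, 1:] - smult l v = p" using shift_minus_scalar_surj by blast
    moreover obtain u where "shift_op M' u = v"
      using less.hyps[OF \<open>degree M' < degree M\<close> \<open>M' \<noteq> 0\<close>] by blast
    ultimately have "shift_op M u = p" by (simp only: M shift_op_linear_times)
    then show ?thesis by blast
  qed
qed

section \<open>Supports of series and causal maps\<close>

definition gps_supp :: "'a::zero gps \<Rightarrow> real set" where
  "gps_supp F = {k. gps_coeff F k \<noteq> 0}"

lemma gps_supp_iff: "k \<in> gps_supp F \<longleftrightarrow> gps_coeff F k \<noteq> 0"
  by (simp add: gps_supp_def)

lemma gps_coeff_sum: "gps_coeff (sum F A) k = (\<Sum>i\<in>A. gps_coeff (F i) k)"
  for F :: "'b \<Rightarrow> 'a::comm_ring_1 gps"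
  by (induction A rule: infinite_finite_induct) (simp_all add: plus_gps.rep_eq zero_gps.rep_eq)

lemma gps_coeff_monom_times:
  fixes F :: "'a::comm_ring_1 gps"
  shows "gps_coeff (gps_monom a c * F) k = c * gps_coeff F (k - a)"
proof -
  have "gps_coeff (gps_monom a c * F) k = (\<Sum>i\<in>{a}. gps_coeff (gps_monom a c) i * gps_coeff F (k - i))"
    by (rule gps_coeff_times) (auto simp: gps_monom.rep_eq split: if_splits)
  then show ?thesis by (simp add: gps_monom.rep_eq)
qed

lemma gps_monom_times: "gps_monom a c * gps_monom b d = gps_monom (a + b) (c * d :: 'a::comm_ring_1)"
  by (rule gps_eqI) (auto simp: gps_coeff_monom_times gps_monom.rep_eq)

lemma gps_supp_times:
  fixes F G :: "'a::comm_ring_1 gps"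
  assumes "k \<in> gps_supp (F * G)"
  obtains i j where "i \<in> gps_supp F" "j \<in> gps_supp G" "k = i + j"
proof -
  have "gps_coeff (F * G) k \<noteq> 0" using assms by (simp add: gps_supp_iff)
  then obtain i where "gps_coeff F i \<noteq> 0" "gps_coeff G (k - i) \<noteq> 0" by (rule gps_times_nonzeroE)
  then show ?thesis by (intro that[of i "k - i"]) (simp_all add: gps_supp_iff)
qed

lemma gps_supp_add: "gps_supp (F + G) \<subseteq> gps_supp F \<union> gps_supp (G :: 'a::comm_ring_1 gps)"
  by (auto simp: gps_supp_iff plus_gps.rep_eq)

lemma gps_supp_one: "gps_supp (1 :: 'a::comm_ring_1 gps) = {0}"
  by (auto simp: gps_supp_iff one_gps.rep_eq split: if_splits)

text \<open>
  A causal map determines the coefficient at the \<open>n\<close>-th smallest exponent of \<open>E\<close> after \<open>n\<close>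
  iterations, so the iterates of \<open>0\<close> converge coefficientwise.
\<close>

lemma causal_fixpoint:
  fixes \<Phi> :: "'a::zero gps \<Rightarrow> 'a gps"
  assumes fin: "\<And>N. finite {k\<in>E. k \<le> N}"
    and zero: "\<And>F. gps_supp F \<subseteq> E \<Longrightarrow> gps_supp (\<Phi> F) \<subseteq> E"
    and causal: "\<And>F G k. gps_supp F \<subseteq> E \<Longrightarrow> gps_supp G \<subseteq> E \<Longrightarrow> k \<in> E \<Longrightarrow>
      (\<And>j. j < k \<Longrightarrow> gps_coeff F j = gps_coeff G j) \<Longrightarrow> gps_coeff (\<Phi> F) k = gps_coeff (\<Phi> G) k"
  shows "\<exists>z. gps_supp z \<subseteq> E \<and> \<Phi> z = z"
proof -
  \<comment> \<open>Counting the exponents up to \<open>k\<close> turns causality into an induction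
    on the number of iterations.\<close>
  define rank where "rank k = card {e\<in>E. e \<le> k}" for k
  \<comment> \<open>\<open>Abs_gps (\<lambda>_. 0)\<close> is the zero series; the coefficients are
    only of class \<open>zero\<close>, while the constant \<open>0\<close> for series comes with the
    ring instance.\<close>
  define F where "F n = (\<Phi> ^^ n) (Abs_gps (\<lambda>_. 0))" for n
  have F0: "gps_coeff (F 0) k = 0" for k by (simp add: F_def Abs_gps_inverse)
  have F_Suc: "F (Suc n) = \<Phi> (F n)" for n by (simp add: F_def)
  have supp: "gps_supp (F n) \<subseteq> E" for n
    by (induction n) (auto simp: F_Suc gps_supp_iff F0 dest: subsetD[OF zero])
  have outside: "gps_coeff G k = 0" if "gps_supp G \<subseteq> E" "k \<notin> E" for G :: "'a gps" and k
    using that by (auto simp: gps_supp_iff subset_iff)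
  have rank_less: "rank j < rank k" if "j < k" "k \<in> E" for j k
  proof -
    have "{e\<in>E. e \<le> j} \<subset> {e\<in>E. e \<le> k}" using that by force
    then show ?thesis unfolding rank_def by (rule psubset_card_mono[OF fin])
  qed
  have stable_step: "gps_coeff (F (Suc n)) k = gps_coeff (F n) k" if "rank k \<le> n" for n k
    using that
  proof (induction n arbitrary: k)
    case 0
    \<comment> \<open>Rank 0 means that no exponent of \<open>E\<close> is at most \<open>k\<close>,
      so both coefficients are 0.\<close>
    then have "{e\<in>E. e \<le> k} = {}" using fin[of k] by (simp add: rank_def)
    then have "k \<notin> E" by auto
    then show ?case using outside supp by metis
  next
    case (Suc n)
    show ?case
    proof (cases "k \<in> E")
      case True
      have "gps_coeff (\<Phi> (F (Suc n))) k = gps_coeff (\<Phi> (F n)) k"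
      proof (rule causal[OF supp supp True])
        fix j assume "j < k"
        then have "rank j \<le> n" using rank_less[OF _ True, of j] Suc.prems by linarith
        then show "gps_coeff (F (Suc n)) j = gps_coeff (F n) j" by (rule Suc.IH)
      qed
      then show ?thesis by (simp only: F_Suc)
    next
      case False
      then show ?thesis using outside supp by metis
    qed
  qed
  have stable: "gps_coeff (F n) k = gps_coeff (F (rank k)) k" if "rank k \<le> n" for n k
    using that by (induction n rule: dec_induct) (simp_all add: stable_step)
  \<comment> \<open>At each exponent the limit takes the value from which the iterates no longer
    change.\<close>
  define z where "z = Abs_gps (\<lambda>k. gps_coeff (F (rank k)) k)"
  have z: "gps_coeff z k = gps_coeff (F (rank k)) k" for k
  proof -
    have "finite {k. k \<le> N \<and> gps_coeff (F (rank k)) k \<noteq> 0}" for N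
      by (rule finite_subset[OF _ fin[of N]]) (use outside supp in blast)
    then show ?thesis unfolding z_def by (subst Abs_gps_inverse) simp_all
  qed
  have zE: "gps_supp z \<subseteq> E" using supp by (fastforce simp: gps_supp_iff z)
  have "\<Phi> z = z"
  proof (rule gps_eqI)
    fix k
    show "gps_coeff (\<Phi> z) k = gps_coeff z k"
    proof (cases "k \<in> E")
      case True
      have "gps_coeff (\<Phi> z) k = gps_coeff (\<Phi> (F (rank k))) k"
      proof (rule causal[OF zE supp True])
        fix j assume "j < k"
        then show "gps_coeff z j = gps_coeff (F (rank k)) j"
          using rank_less[OF _ True, of j] stable[of j "rank k"] by (simp add: z)
      qed
      also have "\<dots> = gps_coeff z k"
        by (simp only: F_Suc[symmetric] stable_step[OF order.refl] z)
      finally show ?thesis .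
    next
      case False
      then show ?thesis using outside zE zero by metis
    qed
  qed
  with zE show ?thesis by blast
qed

section \<open>Products of powers and iterates of \<sigma>\<close>

text \<open>A degree-graded relation between two products is inherited from the factors. The second
  product will be a leading part, a coefficient, or the same monomial at another series.\<close>

lemma graded_prod:
  fixes P :: "nat \<Rightarrow> 'a::comm_monoid_mult \<Rightarrow> 'b::comm_monoid_mult \<Rightarrow> bool"
  assumes one: "P 0 1 1"
    and mult: "\<And>s t F F' G G'. P s F F' \<Longrightarrow> P t G G' \<Longrightarrow> P (s + t) (F * G) (F' * G')"
    and base: "\<And>l. P 1 (z l) (z' l)"
  shows "P (\<Sum>l\<in>A. e l) (\<Prod>l\<in>A. z l ^ e l) (\<Prod>l\<in>A. z' l ^ e l)"
proof (induction A rule: infinite_finite_induct)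
  case (insert l A)
  have "P n (z l ^ n) (z' l ^ n)" for n
  proof (induction n)
    case (Suc n)
    then show ?case using mult[OF base[of l] Suc] by simp
  qed (simp add: one)
  then show ?case using insert mult by simp
qed (simp_all add: one)

lemma gps_coeff_sigma_power:
  "gps_coeff ((sigma lq ^^ l) z) k =
     smult (qpow lq (of_real k) ^ l) (pcompose (gps_coeff z k) [:of_nat l, 1:])"
  by (induction l)
    (simp_all add: sigma.rep_eq pcompose_smult pcompose_assoc[symmetric] pcompose_pCons add.commute)

lemma sigma_power_monom:
  "(sigma lq ^^ l) (gps_monom r [:c:]) = gps_monom r [:qpow lq (of_real r) ^ l * c:]"
  by (rule gps_eqI) (simp add: gps_coeff_sigma_power gps_monom.rep_eq)

lemma gps_supp_sigma_power: "gps_supp ((sigma lq ^^ l) z) \<subseteq> gps_supp z"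
  by (auto simp: gps_supp_iff gps_coeff_sigma_power)

section \<open>Substituting a series into a sum of monomials\<close>

definition mdeg :: "(nat \<Rightarrow>\<^sub>0 nat) \<Rightarrow> nat" where
  "mdeg m = (\<Sum>l\<in>Poly_Mapping.keys m. Poly_Mapping.lookup m l)"

lemma vexp_eq: "vexp p = (fst p, real (mdeg (snd p)))"
  by (simp add: vexp_def mdeg_def)

lemma mdeg_superset:
  assumes "finite A" "Poly_Mapping.keys m \<subseteq> A"
  shows "mdeg m = (\<Sum>l\<in>A. Poly_Mapping.lookup m l)"
  unfolding mdeg_def by (rule sum.mono_neutral_left) (use assms in \<open>auto simp: in_keys_iff\<close>)

lemma mdeg_add: "mdeg (m + m') = mdeg m + mdeg m'"
proof -
  let ?A = "Poly_Mapping.keys m \<union> Poly_Mapping.keys m'"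
  have "mdeg (m + m') = (\<Sum>l\<in>?A. Poly_Mapping.lookup (m + m') l)"
    by (rule mdeg_superset) (auto dest: subsetD[OF keys_add])
  then show ?thesis
    by (simp add: mdeg_superset[of ?A m] mdeg_superset[of ?A m'] lookup_add sum.distrib)
qed

lemma mdeg_0: "mdeg 0 = 0" and mdeg_single: "mdeg (Poly_Mapping.single l n) = n"
  by (simp_all add: mdeg_def)

definition mon_series :: "complex \<Rightarrow> powlog \<Rightarrow> (nat \<Rightarrow>\<^sub>0 nat) \<Rightarrow> powlog" where
  "mon_series lq z m =
     (\<Prod>l\<in>Poly_Mapping.keys m. ((sigma lq ^^ l) z) ^ Poly_Mapping.lookup m l)"

lemma eval_series_superset:
  assumes "finite A" "Poly_Mapping.keys g \<subseteq> A"
  shows "eval_series lq g z =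
    (\<Sum>p\<in>A. gps_monom (fst p) [:Poly_Mapping.lookup g p:] * mon_series lq z (snd p))"
proof -
  have z: "gps_monom a 0 = (0 :: powlog)" for a
    by (rule gps_eqI) (simp add: gps_monom.rep_eq zero_gps.rep_eq)
  have "eval_series lq g z =
    (\<Sum>p\<in>Poly_Mapping.keys g. gps_monom (fst p) [:Poly_Mapping.lookup g p:] * mon_series lq z (snd p))"
    by (simp add: eval_series_def mon_series_def case_prod_beta)
  also have "\<dots> = (\<Sum>p\<in>A. gps_monom (fst p) [:Poly_Mapping.lookup g p:] * mon_series lq z (snd p))"
    by (rule sum.mono_neutral_left) (use assms in \<open>auto simp: in_keys_iff z\<close>)
  finally show ?thesis .
qed

lemma gps_coeff_eval_series:
  "gps_coeff (eval_series lq g z) k =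
    (\<Sum>p\<in>Poly_Mapping.keys g. smult (Poly_Mapping.lookup g p) (gps_coeff (mon_series lq z (snd p)) (k - fst p)))"
  by (simp add: eval_series_superset[OF finite_keys order.refl] gps_coeff_sum gps_coeff_monom_times)

lemma eval_series_add: "eval_series lq (g + h) z = eval_series lq g z + eval_series lq h z"
proof -
  let ?A = "Poly_Mapping.keys g \<union> Poly_Mapping.keys h"
  have A: "finite ?A" "Poly_Mapping.keys (g + h) \<subseteq> ?A" "Poly_Mapping.keys g \<subseteq> ?A"
      "Poly_Mapping.keys h \<subseteq> ?A"
    using keys_add[of g h] by auto
  have "gps_monom a [:u + v:] = gps_monom a [:u:] + gps_monom a [:v::complex:]" for a u v
    by (rule gps_eqI) (simp add: gps_monom.rep_eq plus_gps.rep_eq)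
  then show ?thesis
    unfolding eval_series_superset[OF A(1,2)] eval_series_superset[OF A(1,3)] eval_series_superset[OF A(1,4)]
    by (simp add: lookup_add distrib_right sum.distrib)
qed

lemma eval_series_sum: "eval_series lq (\<Sum>i\<in>I. g i) z = (\<Sum>i\<in>I. eval_series lq (g i) z)"
proof (induction I rule: infinite_finite_induct)
qed (simp_all add: eval_series_add, simp_all add: eval_series_def)

section \<open>The action of the linear part\<close>

lemma linear_qdiff_alt:
  "linear_qdiff L = (\<Sum>i\<le>degree L. Poly_Mapping.single (0, Poly_Mapping.single i 1) (coeff L i))"
  by (simp add: linear_qdiff_def x_monom_def sigma_var_def mult_single)

text \<open>At the exponent \<open>k\<close> each \<sigma> multiplies by \<open>q^k\<close> and
  shifts the coefficient, so \<open>L(\<sigma>)\<close> acts there as \<open>L(q^k T)\<close>; the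
  composed polynomial is \<open>L(q^k X)\<close>.\<close>

lemma gps_coeff_eval_linear_qdiff:
  "gps_coeff (eval_series lq (linear_qdiff L) z) k =
     shift_op (pcompose L [:0, qpow lq (of_real k):]) (gps_coeff z k)"
proof -
  have "gps_coeff (eval_series lq (Poly_Mapping.single (0, Poly_Mapping.single i 1) a) z) k =
     smult a (gps_coeff ((sigma lq ^^ i) z) k)" for i a
    by (simp add: gps_coeff_eval_series mon_series_def)
  then have "gps_coeff (eval_series lq (linear_qdiff L) z) k =
     (\<Sum>i\<le>degree L. smult (coeff L i) (gps_coeff ((sigma lq ^^ i) z) k))"
    by (simp add: linear_qdiff_alt eval_series_sum gps_coeff_sum)
  also have "\<dots> = shift_op (pcompose L [:0, qpow lq (of_real k):]) (gps_coeff z k)"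
    by (subst shift_op_superset[of _ "degree L"])
      (use degree_pcompose_le[of L "[:0, qpow lq (of_real k):]"] in
        \<open>auto simp: gps_coeff_sigma_power coeff_pcompose_linear mult.commute qpow_def\<close>)
  finally show ?thesis .
qed

lemma keys_linear_qdiff: "p \<in> Poly_Mapping.keys (linear_qdiff L) \<Longrightarrow> vexp p = (0, 1)"
  by (auto simp: linear_qdiff_alt vexp_eq mdeg_single split: if_splits
      dest!: subsetD[OF keys_sum])

section \<open>The substitution and the truncated equation\<close>

lemma lookup_single_times:
  fixes g :: "'a::cancel_comm_monoid_add \<Rightarrow>\<^sub>0 'b::comm_semiring_1"
  shows "Poly_Mapping.lookup (Poly_Mapping.single k c * g) (k + p) = c * Poly_Mapping.lookup g p"
  by (simp add: lookup_mult lookup_single when_mult)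

lemma lookup_x_monom_times:
  "Poly_Mapping.lookup (x_monom d c * g) (b, m) = c * Poly_Mapping.lookup g (b - d, m)"
  using lookup_single_times[of "(d, 0)" c g "(b - d, m)"] by (simp add: x_monom_def)

lemma keys_times_cases:
  assumes "p \<in> Poly_Mapping.keys (F * G)"
  obtains p1 p2 where "p1 \<in> Poly_Mapping.keys F" "p2 \<in> Poly_Mapping.keys G" "p = p1 + p2"
  using assms keys_mult[of F G] by blast

lemma keys_add_cases:
  assumes "p \<in> Poly_Mapping.keys (F + G)"
  obtains "p \<in> Poly_Mapping.keys F" | "p \<in> Poly_Mapping.keys G"
  using assms keys_add[of F G] by blast

section \<open>Monomials after the substitution\<close>

text \<open>\<open>b l\<close> stands for the coefficient of \<open>\<sigma>^l (c x^r)\<close>, so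
  this is the image of the monomial \<open>m\<close> under the substitution.\<close>

definition shifted_mon :: "(nat \<Rightarrow> complex) \<Rightarrow> real \<Rightarrow> (nat \<Rightarrow>\<^sub>0 nat) \<Rightarrow> qdiff_sum" where
  "shifted_mon b r m =
     (\<Prod>l\<in>Poly_Mapping.keys m. (x_monom r (b l) + sigma_var l) ^ Poly_Mapping.lookup m l)"

definition mon_value :: "(nat \<Rightarrow> complex) \<Rightarrow> (nat \<Rightarrow>\<^sub>0 nat) \<Rightarrow> complex" where
  "mon_value b m = (\<Prod>l\<in>Poly_Mapping.keys m. b l ^ Poly_Mapping.lookup m l)"

text \<open>The exponent of \<open>x\<close> that the monomial acquires at
  \<open>y = c x^r\<close>.\<close>

definition weight :: "real \<Rightarrow> qdiff_key \<Rightarrow> real" where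
  "weight r p = fst p + r * real (mdeg (snd p))"

lemma weight_add: "weight r (p + p') = weight r p + weight r p'"
  by (simp add: weight_def mdeg_add algebra_simps)

lemma sigma_var_prod:
  "(\<Prod>l\<in>Poly_Mapping.keys m. sigma_var l ^ Poly_Mapping.lookup m l) = Poly_Mapping.single (0, m) 1"
proof -
  have pow: "sigma_var l ^ n = Poly_Mapping.single (0, Poly_Mapping.single l n) 1" for l n
    by (induction n) (simp_all add: sigma_var_def mult_single single_add[symmetric] flip: single_one zero_prod_def)
  have "(\<Prod>l\<in>A. Poly_Mapping.single (0, g l) 1) = (Poly_Mapping.single (0, \<Sum>l\<in>A. g l) 1 :: qdiff_sum)"
    for A :: "nat set" and g
    by (induction A rule: infinite_finite_induct) (simp_all add: mult_single flip: single_one zero_prod_def)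
  moreover have "(\<Sum>l\<in>Poly_Mapping.keys m. Poly_Mapping.single l (Poly_Mapping.lookup m l)) = m"
    by (rule poly_mapping_eqI) (simp add: lookup_sum lookup_single when_def in_keys_iff)
  ultimately show ?thesis by (simp add: pow)
qed

text \<open>Every factor is homogeneous of weight \<open>r\<close> with \<open>\<sigma>^l z\<close>
  as its part of highest degree, and both properties pass to products.\<close>

lemma keys_shifted_mon_minus_leading:
  "p \<in> Poly_Mapping.keys (shifted_mon b r m - Poly_Mapping.single (0, m) 1) \<Longrightarrow>
     weight r p = r * real (mdeg m) \<and> mdeg (snd p) < mdeg m"
proof -
  \<comment> \<open>\<open>F'\<close> is the part of \<open>F\<close> of degree \<open>s\<close>;
    the remainder \<open>F - F'\<close> has the same weight but strictly smaller degree.\<close>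
  define P where "P s F F' \<longleftrightarrow>
    (\<forall>p\<in>Poly_Mapping.keys F'. weight r p = r * real s \<and> mdeg (snd p) = s) \<and>
    (\<forall>p\<in>Poly_Mapping.keys (F - F'). weight r p = r * real s \<and> mdeg (snd p) < s)"
    for s :: nat and F F' :: qdiff_sum
  have "P (\<Sum>l\<in>Poly_Mapping.keys m. Poly_Mapping.lookup m l) (shifted_mon b r m)
      (\<Prod>l\<in>Poly_Mapping.keys m. sigma_var l ^ Poly_Mapping.lookup m l)"
    unfolding shifted_mon_def
  proof (rule graded_prod[where P = P])
    show "P 0 1 1" by (simp add: P_def weight_def mdeg_0)
  next
    fix s t and F F' G G' :: qdiff_sum
    assume F: "P s F F'" and G: "P t G G'"
    \<comment> \<open>Every summand is a product of leading parts and remainders with at least one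
      remainder, which makes the degree drop.\<close>
    have eq: "F * G - F' * G' = F' * (G - G') + (F - F') * G' + (F - F') * (G - G')"
      by (simp add: algebra_simps)
    show "P (s + t) (F * G) (F' * G')"
      unfolding P_def
    proof (intro conjI ballI)
      fix p assume "p \<in> Poly_Mapping.keys (F' * G')"
      then obtain p1 p2 where "p1 \<in> Poly_Mapping.keys F'" "p2 \<in> Poly_Mapping.keys G'" "p = p1 + p2"
        by (rule keys_times_cases)
      with F G show "weight r p = r * real (s + t)" "mdeg (snd p) = s + t"
        by (auto simp: P_def weight_add mdeg_add distrib_left)
    next
      fix p assume "p \<in> Poly_Mapping.keys (F * G - F' * G')"
      then have "weight r p = r * real (s + t) \<and> mdeg (snd p) < s + t"
        unfolding eq
        by (elim keys_add_cases keys_times_cases)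
          (use F G in \<open>auto simp: P_def weight_add mdeg_add distrib_left
            intro: add_less_le_mono add_le_less_mono add_strict_mono\<close>)
      then show "weight r p = r * real (s + t)" "mdeg (snd p) < s + t" by auto
    qed
  next
    show "P 1 (x_monom r (b l) + sigma_var l) (sigma_var l)" for l
      by (auto simp: P_def x_monom_def sigma_var_def weight_def mdeg_0 mdeg_single)
  qed
  then show "p \<in> Poly_Mapping.keys (shifted_mon b r m - Poly_Mapping.single (0, m) 1) \<Longrightarrow>
     weight r p = r * real (mdeg m) \<and> mdeg (snd p) < mdeg m"
    by (simp add: P_def sigma_var_prod mdeg_def)
qed

text \<open>Exponents cannot cancel, so a term free of \<open>z\<close> arises only by taking
  \<open>b l x^r\<close> from every factor.\<close>

lemma lookup_shifted_mon_const:
  "Poly_Mapping.lookup (shifted_mon b r m) (a, 0) = (if a = r * real (mdeg m) then mon_value b m else 0)"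
proof -
  define P where "P s F C \<longleftrightarrow>
    (\<forall>p\<in>Poly_Mapping.keys (F - x_monom (r * real s) C). snd p \<noteq> 0)"
    for s :: nat and F :: qdiff_sum and C :: complex
  have nz: "m1 + m2 \<noteq> 0" if "m1 \<noteq> 0" for m1 m2 :: "nat \<Rightarrow>\<^sub>0 nat"
    using that by (auto simp: poly_mapping_eq_iff fun_eq_iff lookup_add)
  have "P (\<Sum>l\<in>Poly_Mapping.keys m. Poly_Mapping.lookup m l) (shifted_mon b r m) (mon_value b m)"
    unfolding shifted_mon_def mon_value_def
  proof (rule graded_prod[where P = P])
    show "P 0 1 1" by (simp add: P_def x_monom_def flip: zero_prod_def)
  next
    fix s t and F G :: qdiff_sum and C D :: complex
    assume F: "P s F C" and G: "P t G D"
    define X Y where "X = x_monom (r * real s) C" and "Y = x_monom (r * real t) D"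
    have XY: "x_monom (r * real (s + t)) (C * D) = X * Y"
      by (simp add: X_def Y_def x_monom_def mult_single distrib_left)
    \<comment> \<open>Each summand has a factor \<open>F - X\<close> or \<open>G - Y\<close>, all of
      whose terms involve \<open>z\<close>.\<close>
    have eq: "F * G - X * Y = (F - X) * G + (G - Y) * X"
      by (simp add: algebra_simps)
    show "P (s + t) (F * G) (C * D)"
      unfolding P_def XY eq
    proof
      fix p assume "p \<in> Poly_Mapping.keys ((F - X) * G + (G - Y) * X)"
      then show "snd p \<noteq> 0"
        by (elim keys_add_cases keys_times_cases)
          (use F G in \<open>auto simp: P_def X_def Y_def intro!: nz\<close>)
    qed
  next
    fix l :: nat
    have "Poly_Mapping.single l (Suc 0) \<noteq> 0" by (metis lookup_single_eq lookup_zero nat.distinct(1))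
    then show "P 1 (x_monom r (b l) + sigma_var l) (b l)"
      by (simp add: P_def x_monom_def sigma_var_def)
  qed
  then have "(a, 0) \<notin> Poly_Mapping.keys (shifted_mon b r m - x_monom (r * real (mdeg m)) (mon_value b m))"
    unfolding P_def mdeg_def by fastforce
  then show ?thesis
    by (simp add: in_keys_iff lookup_minus x_monom_def lookup_single when_def)
qed

lemma lookup_subst_shift:
  "Poly_Mapping.lookup (subst_shift lq c r f) (b, m') =
     (\<Sum>p\<in>Poly_Mapping.keys f. Poly_Mapping.lookup f p *
        Poly_Mapping.lookup (shifted_mon (\<lambda>l. qpow lq (of_nat l * of_real r) * c) r (snd p)) (b - fst p, m'))"
  by (simp add: subst_shift_def shifted_mon_def case_prod_beta lookup_sum lookup_x_monom_times)

text \<open>Since \<open>\<sigma>^l (c x^r)\<close> has the same coefficient as in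
  \<open>subst_shift\<close>, values of the truncated equation can be compared with the
  \<open>z\<close>-free terms after the substitution.\<close>

lemma mon_series_monom:
  "mon_series lq (gps_monom r [:c:]) m =
     gps_monom (r * real (mdeg m)) [:mon_value (\<lambda>l. qpow lq (of_nat l * of_real r) * c) m:]"
proof -
  define b where "b l = qpow lq (of_nat l * of_real r) * c" for l :: nat
  define P where "P s F C \<longleftrightarrow> F = gps_monom (r * real s) [:C:]" for s :: nat and F :: powlog and C
  have b: "(sigma lq ^^ l) (gps_monom r [:c:]) = gps_monom r [:b l:]" for l
    by (simp add: sigma_power_monom b_def qpow_def exp_of_nat_mult[symmetric] mult.assoc)
  have "P (\<Sum>l\<in>Poly_Mapping.keys m. Poly_Mapping.lookup m l) (mon_series lq (gps_monom r [:c:]) m) (mon_value b m)"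
    unfolding mon_series_def mon_value_def
  proof (rule graded_prod[where P = P])
    show "P 0 1 1" unfolding P_def
      by (rule gps_eqI) (simp add: gps_monom.rep_eq one_gps.rep_eq one_pCons)
  qed (simp_all add: P_def b gps_monom_times distrib_left mult.commute)
  then show ?thesis by (simp add: P_def mdeg_def b_def[abs_def])
qed

section \<open>Least weight and the truncated equation\<close>

text \<open>An extreme point of a hull lies in the generating set, and an edge is the hull of a
  nonempty part of the support. The monomial found here fixes the weight of the truncation.\<close>

lemma boundary_face_meets_supp:
  assumes "boundary_face f \<Gamma>"
  shows "supp f \<inter> \<Gamma> \<noteq> {}"
  using assms unfolding boundary_face_def newton_polygon_def
proof (elim disjE exE conjE)
  fix v assume "v extreme_point_of convex hull supp f" "\<Gamma> = {v}"
  then show ?thesis using extreme_point_of_convex_hull by blast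
next
  assume edge: "\<Gamma> edge_of convex hull supp f"
  have "compact (supp f)" by (simp add: supp_def finite_imp_compact)
  then obtain S' where S': "S' \<subseteq> supp f" "\<Gamma> = convex hull S'"
    using edge face_of_convex_hull_subset unfolding edge_of_def by blast
  have "S' \<noteq> {}" using edge S'(2) by (auto simp: edge_of_def)
  then show ?thesis using S' hull_subset[of S' convex] by blast
qed

lemma lookup_truncation:
  "Poly_Mapping.lookup (truncation f \<Gamma>) p = (if vexp p \<in> \<Gamma> then Poly_Mapping.lookup f p else 0)"
proof -
  have part: "Poly_Mapping.lookup (part f Q) p = (if vexp p = Q then Poly_Mapping.lookup f p else 0)" for Q
    by (simp add: part_def lookup_sum lookup_single when_def in_keys_iff)
  have "finite (supp f \<inter> \<Gamma>)" by (simp add: supp_def)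
  then have "Poly_Mapping.lookup (truncation f \<Gamma>) p =
     (if vexp p \<in> supp f \<inter> \<Gamma> then Poly_Mapping.lookup f p else 0)"
    by (simp add: truncation_def lookup_sum part)
  then show ?thesis by (auto simp: supp_def in_keys_iff)
qed

lemma inner_weight: "(1, r) \<bullet> vexp p = weight r p"
  by (simp add: vexp_eq weight_def)

text \<open>The cone condition makes the monomials on \<open>\<Gamma>\<close> exactly those of least
  weight \<open>w\<close>. At \<open>c x^r\<close> each becomes a multiple of \<open>x^w\<close>, so
  the truncated equation says that one complex sum vanishes.\<close>

lemma truncated_solution_weight:
  assumes "truncated_solution lq f c r"
  obtains w where "\<exists>p\<in>Poly_Mapping.keys f. weight r p = w" "\<And>p. p \<in> Poly_Mapping.keys f \<Longrightarrow> w \<le> weight r p"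
    "(\<Sum>p | p \<in> Poly_Mapping.keys f \<and> weight r p = w.
        Poly_Mapping.lookup f p * mon_value (\<lambda>l. qpow lq (of_nat l * of_real r) * c) (snd p)) = 0"
proof -
  obtain \<Gamma> where face: "boundary_face f \<Gamma>"
    and sol: "formal_solution lq (truncation f \<Gamma>) (gps_monom r [:c:])"
    and cone: "(- 1, - r) \<in> normal_cone f \<Gamma>"
    using assms unfolding truncated_solution_def by blast
  obtain p0 where p0: "p0 \<in> Poly_Mapping.keys f" "vexp p0 \<in> \<Gamma>"
    using boundary_face_meets_supp[OF face] by (auto simp: supp_def)
  define w where "w = weight r p0"
  \<comment> \<open>The cone vector is the negative of \<open>(1, r)\<close>, so maximal scalar
    product means minimal weight.\<close>
  have neg: "(- 1, - r) \<bullet> vexp p = - weight r p" for p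
    by (simp add: vexp_eq weight_def)
  have on: "weight r p = w" if "p \<in> Poly_Mapping.keys f" "vexp p \<in> \<Gamma>" for p
  proof -
    have "(- 1, - r) \<bullet> vexp p = (- 1, - r) \<bullet> vexp p0"
      using cone that p0 unfolding normal_cone_def supp_def by blast
    then show ?thesis by (simp only: neg w_def)
  qed
  have off: "w < weight r p" if "p \<in> Poly_Mapping.keys f" "vexp p \<notin> \<Gamma>" for p
  proof -
    have "(- 1, - r) \<bullet> vexp p < (- 1, - r) \<bullet> vexp p0"
      using cone that p0 unfolding normal_cone_def supp_def by blast
    then show ?thesis by (simp only: neg w_def)
  qed
  let ?v = "mon_value (\<lambda>l. qpow lq (of_nat l * of_real r) * c)"
  have keys: "Poly_Mapping.keys (truncation f \<Gamma>) = {p \<in> Poly_Mapping.keys f. weight r p = w}"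
    using on off by (fastforce simp: in_keys_iff lookup_truncation split: if_splits)
  have "0 = gps_coeff (eval_series lq (truncation f \<Gamma>) (gps_monom r [:c:])) w"
    using sol by (simp add: formal_solution_def)
  also have "\<dots> = (\<Sum>p | p \<in> Poly_Mapping.keys f \<and> weight r p = w. [:Poly_Mapping.lookup f p * ?v (snd p):])"
    unfolding gps_coeff_eval_series keys
  proof (rule sum.cong[OF refl])
    fix p assume "p \<in> {p \<in> Poly_Mapping.keys f. weight r p = w}"
    then have p: "w - fst p = r * real (mdeg (snd p))" "p \<in> Poly_Mapping.keys (truncation f \<Gamma>)"
      using keys by (auto simp: weight_def)
    then have "Poly_Mapping.lookup (truncation f \<Gamma>) p = Poly_Mapping.lookup f p"
      by (simp add: in_keys_iff lookup_truncation split: if_splits)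
    with p show "smult (Poly_Mapping.lookup (truncation f \<Gamma>) p)
        (gps_coeff (mon_series lq (gps_monom r [:c:]) (snd p)) (w - fst p)) =
        [:Poly_Mapping.lookup f p * ?v (snd p):]"
      by (simp add: mon_series_monom gps_monom.rep_eq)
  qed
  finally have "coeff (\<Sum>p | p \<in> Poly_Mapping.keys f \<and> weight r p = w. [:Poly_Mapping.lookup f p * ?v (snd p):]) 0 = 0"
    by simp
  then have "(\<Sum>p | p \<in> Poly_Mapping.keys f \<and> weight r p = w. Poly_Mapping.lookup f p * ?v (snd p)) = 0"
    by (simp add: coeff_sum)
  moreover have "w \<le> weight r p" if "p \<in> Poly_Mapping.keys f" for p
    using on[OF that] off[OF that] by fastforce
  moreover have "\<exists>p\<in>Poly_Mapping.keys f. weight r p = w" using p0(1) by (auto simp: w_def)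
  ultimately show ?thesis using that[of w] by blast
qed

text \<open>Passing to \<open>ft\<close> lowers weights by \<open>d\<close>. A surviving monomial of
  weight \<open>w\<close> gives \<open>d + r \<le> w\<close> by \<open>slope\<close>; a term in
  \<open>x^r\<close> must stem from weight \<open>d + r\<close> in \<open>f\<close>, so
  \<open>w \<le> d + r\<close>. Then its coefficient is the sum in \<open>cancel\<close>.\<close>

lemma truncated_solution_no_const_term:
  assumes trunc_sol: "truncated_solution lq f c r"
    and substitution: "subst_shift lq c r f = x_monom d 1 * ft"
    and slope: "\<And>p. p \<in> Poly_Mapping.keys ft \<Longrightarrow> r \<le> weight r p"
  shows "(r, 0) \<notin> Poly_Mapping.keys ft"
proof
  assume r0: "(r, 0) \<in> Poly_Mapping.keys ft"
  let ?b = "\<lambda>l. qpow lq (of_nat l * of_real r) * c"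
  obtain w where ex: "\<exists>p\<in>Poly_Mapping.keys f. weight r p = w"
    and min: "\<And>p. p \<in> Poly_Mapping.keys f \<Longrightarrow> w \<le> weight r p"
    and cancel: "(\<Sum>p | p \<in> Poly_Mapping.keys f \<and> weight r p = w.
        Poly_Mapping.lookup f p * mon_value ?b (snd p)) = 0"
    using truncated_solution_weight[OF trunc_sol] by blast
  have lookup_ft: "Poly_Mapping.lookup ft (b, m) =
      Poly_Mapping.lookup (subst_shift lq c r f) (d + b, m)" for b m
    by (simp add: substitution lookup_x_monom_times)
  define W where "W = {p \<in> Poly_Mapping.keys f. weight r p = w}"
  have "finite W" "W \<noteq> {}" using ex by (auto simp: W_def)
  obtain a m where am: "(a, m) \<in> W" and max: "\<And>p. p \<in> W \<Longrightarrow> mdeg (snd p) \<le> mdeg m"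
  proof -
    let ?D = "(\<lambda>p. mdeg (snd p)) ` W"
    have "Max ?D \<in> ?D" using \<open>finite W\<close> \<open>W \<noteq> {}\<close> by (intro Max_in) auto
    then obtain p where p: "p \<in> W" "mdeg (snd p) = Max ?D" by auto
    have "mdeg (snd p') \<le> mdeg (snd p)" if "p' \<in> W" for p'
      unfolding p(2) using that \<open>finite W\<close> by (intro Max_ge) auto
    then show ?thesis using that[of "fst p" "snd p"] p(1) by simp
  qed
  \<comment> \<open>Only monomials of the same weight and of larger degree can contribute to \<open>(a, m)\<close> after the
    substitution, and there are none.\<close>
  have "Poly_Mapping.lookup (subst_shift lq c r f) (a, m) =
      (\<Sum>p\<in>{(a, m)}. Poly_Mapping.lookup f p * Poly_Mapping.lookup (shifted_mon ?b r (snd p)) (a - fst p, m))"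
    unfolding lookup_subst_shift
  proof (rule sum.mono_neutral_right)
    show "\<forall>p\<in>Poly_Mapping.keys f - {(a, m)}. Poly_Mapping.lookup f p *
        Poly_Mapping.lookup (shifted_mon ?b r (snd p)) (a - fst p, m) = 0"
    proof (rule ballI, rule ccontr)
      fix p assume p: "p \<in> Poly_Mapping.keys f - {(a, m)}"
        and "Poly_Mapping.lookup f p * Poly_Mapping.lookup (shifted_mon ?b r (snd p)) (a - fst p, m) \<noteq> 0"
      then have "Poly_Mapping.lookup (shifted_mon ?b r (snd p)) (a - fst p, m) \<noteq> 0" by simp
      moreover have "(a - fst p, m) \<noteq> (0, snd p)" using p by (auto simp: prod_eq_iff)
      ultimately have "(a - fst p, m) \<in>
          Poly_Mapping.keys (shifted_mon ?b r (snd p) - Poly_Mapping.single (0, snd p) 1)"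
        by (auto simp: in_keys_iff lookup_minus lookup_single when_def)
      from keys_shifted_mon_minus_leading[OF this]
      have "weight r p = weight r (a, m)" "mdeg m < mdeg (snd p)" by (auto simp: weight_def)
      moreover from this(1) have "p \<in> W" using am p by (simp add: W_def)
      ultimately show False using max by fastforce
    qed
  qed (use am in \<open>auto simp: W_def\<close>)
  also have "\<dots> = Poly_Mapping.lookup f (a, m)"
  proof -
    have "(0, m) \<notin> Poly_Mapping.keys (shifted_mon ?b r m - Poly_Mapping.single (0, m) 1)"
      using keys_shifted_mon_minus_leading[of "(0, m)" ?b r m] by auto
    then show ?thesis by (simp add: in_keys_iff lookup_minus)
  qed
  also have "\<dots> \<noteq> 0" using am by (simp add: W_def in_keys_iff)
  finally have "(a - d, m) \<in> Poly_Mapping.keys ft" by (simp add: in_keys_iff lookup_ft)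
  from slope[OF this] have ge: "d + r \<le> w" using am by (simp add: W_def weight_def)
  \<comment> \<open>This is the entry at \<open>(d + r, 0)\<close> before division by
    \<open>x^d\<close>, and a monomial feeds it only if its weight is \<open>d + r\<close>.\<close>
  have const: "Poly_Mapping.lookup ft (r, 0) =
      (\<Sum>p\<in>Poly_Mapping.keys f. if weight r p = d + r then Poly_Mapping.lookup f p * mon_value ?b (snd p) else 0)"
    unfolding lookup_ft lookup_subst_shift lookup_shifted_mon_const
    by (rule sum.cong[OF refl]) (auto simp: weight_def)
  then have const': "Poly_Mapping.lookup ft (r, 0) =
      (\<Sum>p | p \<in> Poly_Mapping.keys f \<and> weight r p = d + r. Poly_Mapping.lookup f p * mon_value ?b (snd p))"
    by (simp add: sum.inter_filter[symmetric])
  have "{p. p \<in> Poly_Mapping.keys f \<and> weight r p = d + r} \<noteq> {}"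
    using r0 const' by (metis (no_types, lifting) in_keys_iff sum.empty)
  then obtain p where "p \<in> Poly_Mapping.keys f" "weight r p = d + r" by blast
  then have "w \<le> d + r" using min[of p] by simp
  with ge have "d + r = w" by simp
  then show False using r0 const' cancel by (simp add: in_keys_iff)
qed

section \<open>The set of exponents and the formal solution\<close>

lemma supp'_plus_add:
  assumes "P \<in> supp'_plus g C" "Q \<in> supp'_plus g C"
  shows "P + Q \<in> supp'_plus g C"
proof -
  obtain M N where "P = \<Sum>\<^sub># M" "set_mset M \<subseteq> supp' g \<union> (\<lambda>k. (k, - 1)) ` C"
      "Q = \<Sum>\<^sub># N" "set_mset N \<subseteq> supp' g \<union> (\<lambda>k. (k, - 1)) ` C"
    using assms by (auto simp: supp'_plus_def)
  then show ?thesis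
    unfolding supp'_plus_def by (intro CollectI exI[of _ "M + N"]) auto
qed

lemma supp'_plus_zero: "0 \<in> supp'_plus g C"
  unfolding supp'_plus_def by (intro CollectI exI[of _ "{#}"]) auto

lemma supp'_plus_generator: "Q \<in> supp' g \<Longrightarrow> Q \<in> supp'_plus g C"
  unfolding supp'_plus_def by (intro CollectI exI[of _ "{#Q#}"]) auto

lemma K_set_mono: "C \<subseteq> D \<Longrightarrow> K_set g C \<subseteq> K_set g D"
  unfolding K_set_def supp'_plus_def by blast

section \<open>Local finiteness of the exponents\<close>

text \<open>Zeros do not change a sum, and a positive \<open>w\<close> occurs at most
  \<open>N / w\<close> times because the other summands are nonnegative.\<close>

lemma finite_bounded_sums:
  fixes W :: "real set"
  assumes "finite W" "\<And>w. w \<in> W \<Longrightarrow> 0 \<le> w"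
  shows "finite {\<Sum>\<^sub># M | M. set_mset M \<subseteq> W \<and> \<Sum>\<^sub># M \<le> N}"
  using assms
proof (induction W arbitrary: N rule: finite_induct)
  case empty
  then show ?case by simp
next
  case (insert w W)
  show ?case
  proof (cases "w = 0")
    case True
    have "{\<Sum>\<^sub># M | M. set_mset M \<subseteq> insert w W \<and> \<Sum>\<^sub># M \<le> N} \<subseteq>
        {\<Sum>\<^sub># M | M. set_mset M \<subseteq> W \<and> \<Sum>\<^sub># M \<le> N}"
    proof safe
      fix M assume M: "set_mset M \<subseteq> insert w W" "\<Sum>\<^sub># M \<le> N"
      have "\<Sum>\<^sub># (filter_mset (\<lambda>v. v \<noteq> 0) M) = \<Sum>\<^sub># M" by (induction M) auto
      moreover have "set_mset (filter_mset (\<lambda>v. v \<noteq> 0) M) \<subseteq> W" using M True by auto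
      ultimately show "\<exists>M'. \<Sum>\<^sub># M = \<Sum>\<^sub># M' \<and> set_mset M' \<subseteq> W \<and> \<Sum>\<^sub># M' \<le> N"
        using M(2) by metis
    qed
    then show ?thesis by (rule finite_subset) (use insert in auto)
  next
    case False
    then have w: "0 < w" using insert.prems by force
    define n where "n = nat \<lceil>N / w\<rceil>"
    have "{\<Sum>\<^sub># M | M. set_mset M \<subseteq> insert w W \<and> \<Sum>\<^sub># M \<le> N} \<subseteq>
        (\<Union>i\<le>n. (\<lambda>s. real i * w + s) ` {\<Sum>\<^sub># M | M. set_mset M \<subseteq> W \<and> \<Sum>\<^sub># M \<le> N})"
    proof safe
      fix M assume M: "set_mset M \<subseteq> insert w W" "\<Sum>\<^sub># M \<le> N"
      define M' where "M' = filter_mset (\<lambda>v. v \<noteq> w) M"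
      have sum: "\<Sum>\<^sub># M = real (count M w) * w + \<Sum>\<^sub># M'"
        unfolding M'_def by (induction M) (auto simp: algebra_simps)
      have M': "set_mset M' \<subseteq> W" using M by (auto simp: M'_def)
      then have "0 \<le> \<Sum>\<^sub># M'"
        using insert.prems by (induction M') (auto intro!: add_nonneg_nonneg)
      then have "real (count M w) * w \<le> N" using M(2) sum by simp
      then have "real (count M w) \<le> N / w" using w by (simp add: field_simps)
      then have "count M w \<le> n" unfolding n_def by linarith
      moreover have "\<Sum>\<^sub># M' \<le> N" using sum M(2) w by (smt (verit) mult_nonneg_nonneg of_nat_0_le_iff)
      ultimately show "\<Sum>\<^sub># M \<in> (\<Union>i\<le>n. (\<lambda>s. real i * w + s) `
          {\<Sum>\<^sub># M | M. set_mset M \<subseteq> W \<and> \<Sum>\<^sub># M \<le> N})"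
        using sum M' by blast
    qed
    then show ?thesis
      by (rule finite_subset) (use insert in \<open>intro finite_UN_I finite_imageI; auto\<close>)
  qed
qed

text \<open>The functional \<open>(1, r)\<close> sends \<open>(k, -1)\<close> to
  \<open>k - r\<close> and the generators to finitely many nonnegative numbers, so bounded
  \<open>k\<close> means bounded sums.\<close>

lemma K_set_locally_finite:
  assumes slope: "\<And>Q. Q \<in> supp' g \<Longrightarrow> (1, r) \<bullet> Q \<ge> 0"
  shows "finite {k \<in> K_set g {}. k \<le> N}"
proof -
  define W where "W = (\<lambda>Q. (1, r) \<bullet> Q) ` supp' g"
  have W: "finite W" "\<And>w. w \<in> W \<Longrightarrow> 0 \<le> w"
    using slope by (auto simp: W_def supp'_def supp_def)
  have inner: "(1, r) \<bullet> \<Sum>\<^sub># M = (\<Sum>Q\<in>#M. (1, r) \<bullet> Q)" for M :: "(real \<times> real) multiset"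
    by (induction M) (simp_all add: inner_add_right)
  have "{k \<in> K_set g {}. k \<le> N} \<subseteq>
      (\<lambda>s. r + s) ` {\<Sum>\<^sub># M | M. set_mset M \<subseteq> W \<and> \<Sum>\<^sub># M \<le> N - r}"
  proof safe
    fix k assume "k \<in> K_set g {}" "k \<le> N"
    then obtain M where M: "(k, - 1) = \<Sum>\<^sub># M" "set_mset M \<subseteq> supp' g"
      by (auto simp: K_set_def supp'_plus_def)
    let ?M = "image_mset (\<lambda>Q. (1, r) \<bullet> Q) M"
    have "\<Sum>\<^sub># ?M = k - r" unfolding inner[symmetric] M(1)[symmetric] by simp
    moreover have "set_mset ?M \<subseteq> W" using M(2) by (auto simp: W_def)
    ultimately have "k - r \<in> {\<Sum>\<^sub># M | M. set_mset M \<subseteq> W \<and> \<Sum>\<^sub># M \<le> N - r}"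
      using \<open>k \<le> N\<close> by (intro CollectI exI[of _ ?M]) auto
    then show "k \<in> (\<lambda>s. r + s) ` {\<Sum>\<^sub># M | M. set_mset M \<subseteq> W \<and> \<Sum>\<^sub># M \<le> N - r}"
      by (intro image_eqI[of _ _ "k - r"]) auto
  qed
  then show ?thesis by (rule finite_subset) (intro finite_imageI finite_bounded_sums W)
qed

section \<open>Exponents and causality of monomials in a series\<close>

text \<open>Each factor \<open>\<sigma>^l z\<close> adds a vector \<open>(k, -1)\<close>. An
  arbitrary additive set \<open>A\<close> lets the semigroup and a lower bound be tracked
  together.\<close>

lemma gps_supp_mon_series:
  assumes "0 \<in> A" "\<And>P Q. P \<in> A \<Longrightarrow> Q \<in> A \<Longrightarrow> P + Q \<in> A"
    and "\<And>k. k \<in> gps_supp z \<Longrightarrow> (k, - 1) \<in> A"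
    and "k \<in> gps_supp (mon_series lq z m)"
  shows "(k, - real (mdeg m)) \<in> A"
proof -
  define P where "P s F F' \<longleftrightarrow> (\<forall>k\<in>gps_supp F. (k, - real s) \<in> A)" for s :: nat and F F' :: powlog
  have "P (\<Sum>l\<in>Poly_Mapping.keys m. Poly_Mapping.lookup m l) (mon_series lq z m) (mon_series lq z m)"
    unfolding mon_series_def
  proof (rule graded_prod[where P = P])
    show "P 0 1 1" using assms(1) by (simp add: P_def gps_supp_one zero_prod_def)
  next
    fix s t and F F' G G' :: powlog
    assume F: "P s F F'" and G: "P t G G'"
    show "P (s + t) (F * G) (F' * G')"
      unfolding P_def
    proof
      fix k assume "k \<in> gps_supp (F * G)"
      then obtain i j where "i \<in> gps_supp F" "j \<in> gps_supp G" "k = i + j" by (rule gps_supp_times)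
      then show "(k, - real (s + t)) \<in> A"
        using F G assms(2)[of "(i, - real s)" "(j, - real t)"] by (simp add: P_def)
    qed
  next
    show "P 1 ((sigma lq ^^ l) z) ((sigma lq ^^ l) z)" for l
      using gps_supp_sigma_power[of l lq z] assms(3) by (auto simp: P_def)
  qed
  then show ?thesis using assms(4) by (simp add: P_def mdeg_def)
qed

text \<open>Exchanging one factor at a time leaves products of one difference, of order at least
  \<open>k0\<close>, and \<open>mdeg m - 1\<close> factors of order at least
  \<open>b\<close>.\<close>

lemma gps_supp_mon_series_diff:
  assumes z: "\<And>k. k \<in> gps_supp z \<Longrightarrow> b \<le> k" and z': "\<And>k. k \<in> gps_supp z' \<Longrightarrow> b \<le> k"
    and agree: "\<And>j. j < k0 \<Longrightarrow> gps_coeff z j = gps_coeff z' j"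
    and k: "k \<in> gps_supp (mon_series lq z m - mon_series lq z' m)"
  shows "k0 + (real (mdeg m) - 1) * b \<le> k"
proof -
  define P where "P s F F' \<longleftrightarrow> (\<forall>k\<in>gps_supp F \<union> gps_supp F'. real s * b \<le> k) \<and>
      (\<forall>k\<in>gps_supp (F - F'). k0 + (real s - 1) * b \<le> k)" for s :: nat and F F' :: powlog
  have "P (\<Sum>l\<in>Poly_Mapping.keys m. Poly_Mapping.lookup m l) (mon_series lq z m) (mon_series lq z' m)"
    unfolding mon_series_def
  proof (rule graded_prod[where P = P])
    show "P 0 1 1" by (simp add: P_def gps_supp_one) (simp add: gps_supp_def zero_gps.rep_eq)
  next
    fix s t and F F' G G' :: powlog
    assume F: "P s F F'" and G: "P t G G'"
    have eq: "F * G - F' * G' = F * (G - G') + (F - F') * G'" by (simp add: algebra_simps)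
    have "real (s + t) * b \<le> k" if "k \<in> gps_supp (F * G) \<union> gps_supp (F' * G')" for k
      using that F G by (auto simp: P_def distrib_right elim!: gps_supp_times intro!: add_mono)
    moreover have "k0 + (real (s + t) - 1) * b \<le> k" if "k \<in> gps_supp (F * G - F' * G')" for k
    proof -
      have "k \<in> gps_supp (F * (G - G')) \<or> k \<in> gps_supp ((F - F') * G')"
        using that gps_supp_add[of "F * (G - G')" "(F - F') * G'"] unfolding eq by blast
      then show ?thesis
      proof
        assume "k \<in> gps_supp (F * (G - G'))"
        then obtain i j where "i \<in> gps_supp F" "j \<in> gps_supp (G - G')" "k = i + j" by (rule gps_supp_times)
        then have "real s * b \<le> i" "k0 + (real t - 1) * b \<le> j" "k = i + j"
          using F G by (auto simp: P_def)
        then show ?thesis by (simp add: algebra_simps)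
      next
        assume "k \<in> gps_supp ((F - F') * G')"
        then obtain i j where "i \<in> gps_supp (F - F')" "j \<in> gps_supp G'" "k = i + j" by (rule gps_supp_times)
        then have "k0 + (real s - 1) * b \<le> i" "real t * b \<le> j" "k = i + j"
          using F G by (auto simp: P_def)
        then show ?thesis by (simp add: algebra_simps)
      qed
    qed
    ultimately show "P (s + t) (F * G) (F' * G')" by (simp add: P_def)
  next
    fix l
    have "k0 \<le> k" if "k \<in> gps_supp ((sigma lq ^^ l) z - (sigma lq ^^ l) z')" for k
    proof (rule ccontr)
      assume "\<not> k0 \<le> k"
      with that agree show False
        by (simp add: gps_supp_iff minus_gps.rep_eq gps_coeff_sigma_power)
    qed
    then show "P 1 ((sigma lq ^^ l) z) ((sigma lq ^^ l) z')"
      using gps_supp_sigma_power[of l lq] z z' by (fastforce simp: P_def)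
  qed
  then show ?thesis using k by (simp add: P_def mdeg_def)
qed

lemma mdeg_eq_0_iff: "mdeg m = 0 \<longleftrightarrow> m = 0"
  by (auto simp: mdeg_def poly_mapping_eq_iff fun_eq_iff in_keys_iff)

section \<open>Solving the equation\<close>

text \<open>Fixing 0 as the preimage of 0 ensures that inverting the linear part creates no new
  exponents.\<close>

lemma linear_part_inverse:
  assumes "L \<noteq> 0"
  obtains I where "\<And>k. I k 0 = 0"
    "\<And>k p. shift_op (pcompose L [:0, qpow lq (complex_of_real k):]) (I k p) = p"
proof -
  let ?M = "\<lambda>k. pcompose L [:0, qpow lq (complex_of_real k):]"
  have "\<exists>u. shift_op (?M k) u = p \<and> (p = 0 \<longrightarrow> u = 0)" for k p
  proof (cases "p = 0")
    case True
    then show ?thesis by (intro exI[of _ 0]) (simp add: shift_op_def)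
  next
    case False
    \<comment> \<open>\<open>q^k\<close> is a value of \<open>exp\<close>, hence nonzero, so
      \<open>L(q^k X)\<close> inherits \<open>L \<noteq> 0\<close>.\<close>
    have "?M k \<noteq> 0" using assms by (subst pcompose_eq_0_iff) (simp_all add: qpow_def)
    then show ?thesis using shift_op_surj False by blast
  qed
  then obtain I where "\<And>k p. shift_op (?M k) (I k p) = p \<and> (p = 0 \<longrightarrow> I k p = 0)" by metis
  then show ?thesis using that[of I] by blast
qed

lemma formal_solution_exists:
  assumes form: "ft = linear_qdiff L + h" and "L \<noteq> 0"
    and only_L: "(0, 1) \<notin> supp h"
    and slope: "\<And>Q. Q \<in> supp' ft \<Longrightarrow> (1, r) \<bullet> Q \<ge> 0"
    and const: "(r, 0) \<notin> Poly_Mapping.keys ft"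
  shows "\<exists>z. formal_solution lq ft z \<and> (\<forall>k\<in>gps_supp z. k \<in> K_set ft {} \<and> r < k)"
proof -
  define E where "E = {k \<in> K_set ft {}. r < k}"
  have finE: "finite {k \<in> E. k \<le> N}" for N
    by (rule finite_subset[OF _ K_set_locally_finite[of ft r N, OF slope]]) (auto simp: E_def)
  \<comment> \<open>Local finiteness gives a uniform gap above \<open>r\<close>;
    \<open>r + 1\<close> serves as the bound when no exponent lies in between.\<close>
  obtain b where b: "r < b" "\<And>k. k \<in> E \<Longrightarrow> b \<le> k"
  proof
    let ?F = "insert (r + 1) {k \<in> E. k \<le> r + 1}"
    have F: "finite ?F" using finE by simp
    have "Min ?F \<in> ?F" using F by (intro Min_in) auto
    then show "r < Min ?F" by (auto simp: E_def)
    show "Min ?F \<le> k" if "k \<in> E" for k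
    proof (cases "k \<le> r + 1")
      case True
      then show ?thesis using that by (intro Min_le[OF F]) simp
    next
      case False
      then show ?thesis using Min_le[OF F, of "r + 1"] by simp
    qed
  qed
  have key_h: "p \<in> Poly_Mapping.keys ft" "vexp p \<noteq> (0, 1)" "r \<le> weight r p"
    if "p \<in> Poly_Mapping.keys h" for p
  proof -
    show ne: "vexp p \<noteq> (0, 1)" using that only_L by (force simp: supp_def)
    \<comment> \<open>The linear part and \<open>h\<close> share no monomial, so nothing of
      \<open>h\<close> cancels in \<open>ft\<close>.\<close>
    then have "p \<notin> Poly_Mapping.keys (linear_qdiff L)" using keys_linear_qdiff by blast
    with that show p: "p \<in> Poly_Mapping.keys ft" by (simp add: form in_keys_iff lookup_add)
    then have "(1, r) \<bullet> (vexp p - (0, 1)) \<ge> 0" by (intro slope) (auto simp: supp'_def supp_def)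
    then show "r \<le> weight r p" by (simp add: inner_diff_right inner_weight)
  qed

  obtain I where I: "\<And>k. I k 0 = 0"
    "\<And>k p. shift_op (pcompose L [:0, qpow lq (complex_of_real k):]) (I k p) = p"
    using linear_part_inverse[OF \<open>L \<noteq> 0\<close>] by metis
  \<comment> \<open>\<open>\<Phi> F\<close> solves \<open>L(\<sigma>) z = - h(x, F)\<close> for
    \<open>z\<close>, exponent by exponent.\<close>
  define \<Phi> where "\<Phi> F = Abs_gps (\<lambda>k. I k (- gps_coeff (eval_series lq h F) k))" for F
  have \<Phi>: "gps_coeff (\<Phi> F) k = I k (- gps_coeff (eval_series lq h F) k)" for F k
  proof -
    have "finite {k. k \<le> N \<and> I k (- gps_coeff (eval_series lq h F) k) \<noteq> 0}" for N
      by (rule finite_subset[OF _ finite_gps_coeff[of N "eval_series lq h F"]]) (auto simp: I(1))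
    then show ?thesis unfolding \<Phi>_def by (subst Abs_gps_inverse) simp_all
  qed

  have "\<exists>z. gps_supp z \<subseteq> E \<and> \<Phi> z = z"
  proof (rule causal_fixpoint[OF finE])
    fix F :: powlog assume F: "gps_supp F \<subseteq> E"
    \<comment> \<open>A point \<open>(u, -s)\<close> of \<open>A\<close> lies in the semigroup and
      satisfies \<open>u \<ge> s b\<close>, as for a product of \<open>s\<close> series of order at
      least \<open>b\<close>.\<close>
    define A where "A = supp'_plus ft {} \<inter> {P. - snd P * b \<le> fst P}"
    have A: "0 \<in> A" "\<And>P Q. P \<in> A \<Longrightarrow> Q \<in> A \<Longrightarrow> P + Q \<in> A"
      by (auto simp: A_def supp'_plus_zero supp'_plus_add algebra_simps)
    have FA: "(k, - 1) \<in> A" if "k \<in> gps_supp F" for k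
      using that F b(2) by (auto simp: A_def E_def K_set_def)
    show "gps_supp (\<Phi> F) \<subseteq> E"
    proof
      fix k assume "k \<in> gps_supp (\<Phi> F)"
      then have "gps_coeff (eval_series lq h F) k \<noteq> 0" using I(1) by (auto simp: gps_supp_iff \<Phi>)
      then obtain p where p: "p \<in> Poly_Mapping.keys h"
        and "smult (Poly_Mapping.lookup h p) (gps_coeff (mon_series lq F (snd p)) (k - fst p)) \<noteq> 0"
        unfolding gps_coeff_eval_series by (rule sum.not_neutral_contains_not_neutral)
      then have "k - fst p \<in> gps_supp (mon_series lq F (snd p))" by (auto simp: gps_supp_iff)
      from gps_supp_mon_series[OF A FA this] have kA: "(k - fst p, - real (mdeg (snd p))) \<in> A" .
      \<comment> \<open>For \<open>vexp p = (a, j)\<close>, adding \<open>(a, j - 1)\<close> to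
        \<open>(k - a, -j)\<close> yields \<open>(k, -1)\<close>.\<close>
      have "vexp p - (0, 1) \<in> supp'_plus ft {}"
        using key_h(1)[OF p] by (intro supp'_plus_generator) (auto simp: supp'_def supp_def)
      from supp'_plus_add[OF this, of "(k - fst p, - real (mdeg (snd p)))"] kA
      have K: "k \<in> K_set ft {}" by (simp add: A_def K_set_def vexp_eq)
      have ge: "fst p + real (mdeg (snd p)) * b \<le> k" using kA by (simp add: A_def)
      \<comment> \<open>A monomial free of \<open>z\<close> has exponent at least \<open>r\<close>,
        and \<open>const\<close> excludes \<open>r\<close>; any other gains strictness from
        \<open>b > r\<close>.\<close>
      have "r < k"
      proof (cases "snd p = 0")
        case True
        then have "fst p \<noteq> r" using const key_h(1)[OF p] by (metis prod.collapse)
        then show ?thesis using key_h(3)[OF p] ge True by (simp add: weight_def mdeg_0)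
      next
        case False
        then have "real (mdeg (snd p)) * r < real (mdeg (snd p)) * b"
          using b(1) mdeg_eq_0_iff[of "snd p"] by (intro mult_strict_left_mono) auto
        then show ?thesis using key_h(3)[OF p] ge by (simp add: weight_def mult.commute)
      qed
      with K show "k \<in> E" by (simp add: E_def)
    qed
  next
    fix F G :: powlog and k :: real
    assume F: "gps_supp F \<subseteq> E" and G: "gps_supp G \<subseteq> E"
      and agree: "\<And>j. j < k \<Longrightarrow> gps_coeff F j = gps_coeff G j"
    have "gps_coeff (mon_series lq F (snd p)) (k - fst p) = gps_coeff (mon_series lq G (snd p)) (k - fst p)"
      if p: "p \<in> Poly_Mapping.keys h" for p
    proof (rule ccontr)
      let ?s = "real (mdeg (snd p))"
      assume ne: "\<not> ?thesis"
      then have "k - fst p \<in> gps_supp (mon_series lq F (snd p) - mon_series lq G (snd p))"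
        by (simp add: gps_supp_iff minus_gps.rep_eq)
      then have "k + (?s - 1) * b \<le> k - fst p"
        by (rule gps_supp_mon_series_diff[rotated 3]) (use F G b(2) agree in auto)
      \<comment> \<open>With \<open>s\<close> the degree of \<open>p\<close>, the weight bound
        forces \<open>s \<le> 1\<close>. For \<open>s = 0\<close> the series is 1 on both sides, and
        \<open>s = 1\<close> forces \<open>vexp p = (0, 1)\<close>, which \<open>only_L\<close>
        excludes.\<close>
      then have le: "(?s - 1) * b \<le> (?s - 1) * r" "(?s - 1) * b \<le> - fst p"
        using key_h(3)[OF p] by (simp_all add: weight_def algebra_simps)
      have "snd p \<noteq> 0" using ne by (auto simp: mon_series_def)
      then have "1 \<le> mdeg (snd p)" using mdeg_eq_0_iff[of "snd p"] by linarith
      moreover have "\<not> 1 < ?s"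
      proof
        assume "1 < ?s"
        then have "(?s - 1) * r < (?s - 1) * b" using b(1) by simp
        with le(1) show False by simp
      qed
      ultimately have s: "mdeg (snd p) = 1" by simp
      then have "fst p \<le> 0" "0 \<le> fst p" using le(2) key_h(3)[OF p] by (simp_all add: weight_def)
      with s have "vexp p = (0, 1)" by (simp add: vexp_eq)
      with key_h(2)[OF p] show False by contradiction
    qed
    then show "gps_coeff (\<Phi> F) k = gps_coeff (\<Phi> G) k"
      unfolding \<Phi> gps_coeff_eval_series by (simp cong: sum.cong)
  qed
  then obtain z where z: "gps_supp z \<subseteq> E" "\<Phi> z = z" by blast
  have "gps_coeff (eval_series lq ft z) k = 0" for k
  proof -
    \<comment> \<open>Only the coefficient of \<open>z\<close> on the left is replaced by that of
      \<open>\<Phi> z\<close>; the right-inverse property of \<open>I\<close> does the rest.\<close>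
    have "gps_coeff (eval_series lq (linear_qdiff L) z) k = - gps_coeff (eval_series lq h z) k"
      unfolding gps_coeff_eval_linear_qdiff by (subst z(2)[symmetric]) (simp only: \<Phi> I(2))
    then show ?thesis by (simp add: form eval_series_add plus_gps.rep_eq)
  qed
  with z(1) show ?thesis by (auto simp: formal_solution_def E_def)
qed

theorem mainTheorem2:
  fixes q lq c :: complex and r d :: real and n :: nat
    and f ft h :: qdiff_sum and L :: "complex poly"
  assumes q_nonzero: "q \<noteq> 0"
    and q_not_root_of_unity: "\<And>k::nat. k > 0 \<Longrightarrow> q ^ k \<noteq> 1"
    and log_q: "exp lq = q"
    and f_polynomial: "qdiff_polynomial n f"
    and f_nonzero: "f \<noteq> 0"
    and trunc_sol: "truncated_solution lq f c r"
    and substitution: "subst_shift lq c r f = x_monom d 1 * ft"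
    and form: "ft = linear_qdiff L + h"
    and vertex: "(0, 1) extreme_point_of newton_polygon ft"
    and L_nonzero: "L \<noteq> 0"
    and only_L: "(0, 1) \<notin> supp h"
    and slope: "\<And>Q. Q \<in> supp' ft \<Longrightarrow> (1, r) \<bullet> Q \<ge> 0"
  shows "\<exists>z :: powlog. formal_solution lq ft z \<and>
           (\<forall>k. gps_coeff z k \<noteq> 0 \<longrightarrow> k \<in> K_set ft (critical_numbers lq L r) \<and> k > r)"
proof -
  \<comment> \<open>Subtracting \<open>(0, 1)\<close> lowers the scalar product with
    \<open>(1, r)\<close> by \<open>r\<close>, so the slope hypothesis bounds weights by
    \<open>r\<close>.\<close>
  have "r \<le> weight r p" if "p \<in> Poly_Mapping.keys ft" for p
  proof -
    have "(1, r) \<bullet> (vexp p - (0, 1)) \<ge> 0"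
      using that by (intro slope) (auto simp: supp'_def supp_def)
    then show ?thesis by (simp add: inner_diff_right inner_weight)
  qed
  then have "(r, 0) \<notin> Poly_Mapping.keys ft"
    by (rule truncated_solution_no_const_term[OF trunc_sol substitution])
  from formal_solution_exists[OF form L_nonzero only_L slope this, of lq] obtain z
    where "formal_solution lq ft z" "\<forall>k\<in>gps_supp z. k \<in> K_set ft {} \<and> r < k" by blast
  \<comment> \<open>Adding the vectors of the critical numbers as generators keeps all exponents
    admissible.\<close>
  then show ?thesis using K_set_mono[of "{}" "critical_numbers lq L r" ft]
    by (intro exI[of _ z]) (auto simp: gps_supp_iff)
qed

end
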